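(* Let $G$ be a second countable locally compact group and $H$ a closed subgroup of $G$. The following conditions are equivalent: (i) There exists a proper $G$-invariant compatible metric on $G/H$. (ii) There exist a metrizable locally compact group $G'$, a continuous homomorphism $\varphi$ from $G$ into $G'$, and a compact subgroup $H'$ of $G'$ such that (a) $\varphi(H)\subset H'$; (b) the map $\tilde\varphi : G/H\to G'/H'$, $gH\mapsto \varphi(g)H'$, induced by $\varphi$ is a homeomorphism.
   Context: All topological spaces and topological groups are Hausdorff. For a closed subgroup $H$ of a topological group $G$, the coset space $G/H=\{gH : g\in G\}$ carries the quotient topology, and $G$ acts on it by left translation. A compatible metric on a topological space is a metric inducing its topology. A metric $d$ on $G/H$ is $G$-invariant if $d(gx,gy)=d(x,y)$ for all $g\in G$ and $x,y\in G/H$. A metric is proper if all its closed balls $\{y : d(x,y)\le r\}$ are compact. *)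

theory Defs
  imports "HOL-Analysis.Analysis" "HOL-Algebra.Left_Coset"
begin

locale topological_group = group G for G (structure) and T :: "'a topology" +
  assumes topspace_eq: "topspace T = carrier G"
    and Hausdorff: "Hausdorff_space T"
    and continuous_mult: "continuous_map (prod_topology T T) T (\<lambda>(x, y). x \<otimes> y)"
    and continuous_inv: "continuous_map T T (\<lambda>x. inv x)"

definition coset_topology :: "('a, 'm) monoid_scheme \<Rightarrow> 'a topology \<Rightarrow> 'a set \<Rightarrow> 'a set topology"
  where "coset_topology G T H =
    topology (\<lambda>\<U>. \<U> \<subseteq> lcosets\<^bsub>G\<^esub> H \<and> openin T {g \<in> topspace T. g <#\<^bsub>G\<^esub> H \<in> \<U>})"

lemma openin_coset_topology:
  "openin (coset_topology G T H) \<U> \<longleftrightarrow>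
     \<U> \<subseteq> lcosets\<^bsub>G\<^esub> H \<and> openin T {g \<in> topspace T. g <#\<^bsub>G\<^esub> H \<in> \<U>}"
proof -
  have "istopology (\<lambda>\<U>. \<U> \<subseteq> lcosets\<^bsub>G\<^esub> H \<and> openin T {g \<in> topspace T. g <#\<^bsub>G\<^esub> H \<in> \<U>})"
    unfolding istopology_def
  proof (intro conjI allI impI)
    fix \<U> \<V>
    assume U: "\<U> \<subseteq> lcosets\<^bsub>G\<^esub> H \<and> openin T {g \<in> topspace T. g <#\<^bsub>G\<^esub> H \<in> \<U>}"
      and V: "\<V> \<subseteq> lcosets\<^bsub>G\<^esub> H \<and> openin T {g \<in> topspace T. g <#\<^bsub>G\<^esub> H \<in> \<V>}"
    show "\<U> \<inter> \<V> \<subseteq> lcosets\<^bsub>G\<^esub> H" using U by blast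
    have "{g \<in> topspace T. g <#\<^bsub>G\<^esub> H \<in> \<U> \<inter> \<V>} =
        {g \<in> topspace T. g <#\<^bsub>G\<^esub> H \<in> \<U>} \<inter> {g \<in> topspace T. g <#\<^bsub>G\<^esub> H \<in> \<V>}"
      by blast
    then show "openin T {g \<in> topspace T. g <#\<^bsub>G\<^esub> H \<in> \<U> \<inter> \<V>}"
      using U V by (simp add: openin_Int)
  next
    fix \<K>
    assume K: "\<forall>\<U>\<in>\<K>. \<U> \<subseteq> lcosets\<^bsub>G\<^esub> H \<and> openin T {g \<in> topspace T. g <#\<^bsub>G\<^esub> H \<in> \<U>}"
    show "\<Union>\<K> \<subseteq> lcosets\<^bsub>G\<^esub> H" using K by blast
    have "{g \<in> topspace T. g <#\<^bsub>G\<^esub> H \<in> \<Union>\<K>} =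
        (\<Union>\<U>\<in>\<K>. {g \<in> topspace T. g <#\<^bsub>G\<^esub> H \<in> \<U>})"
      by blast
    then show "openin T {g \<in> topspace T. g <#\<^bsub>G\<^esub> H \<in> \<Union>\<K>}"
      using K by auto
  qed
  then show ?thesis
    by (simp add: coset_topology_def)
qed

lemma (in topological_group) topspace_coset_topology:
  "topspace (coset_topology G T H) = lcosets H"
proof -
  have "{g \<in> topspace T. g <#\<^bsub>G\<^esub> H \<in> lcosets H} = topspace T"
    by (auto simp: LCOSETS_def topspace_eq)
  then have "openin (coset_topology G T H) (lcosets H)"
    by (simp add: openin_coset_topology)
  then show ?thesis
    unfolding topspace_def by (auto simp: openin_coset_topology)
qed

lemma (in topological_group) quotient_map_coset_topology:
  "quotient_map T (coset_topology G T H) (\<lambda>g. g <#\<^bsub>G\<^esub> H)"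
  unfolding quotient_map_def topspace_coset_topology openin_coset_topology topspace_eq
  by (auto simp: LCOSETS_def)

definition proper_metric :: "'a set \<Rightarrow> ('a \<Rightarrow> 'a \<Rightarrow> real) \<Rightarrow> bool"
  where "proper_metric M d \<longleftrightarrow> Metric_space M d \<and>
    (\<forall>x\<in>M. \<forall>r. compactin (Metric_space.mtopology M d) (Metric_space.mcball M d x r))"

definition invariant_metric ::
    "('a, 'm) monoid_scheme \<Rightarrow> 'a set \<Rightarrow> ('a set \<Rightarrow> 'a set \<Rightarrow> real) \<Rightarrow> bool"
  where "invariant_metric G H d \<longleftrightarrow>
    (\<forall>g\<in>carrier G. \<forall>X\<in>lcosets\<^bsub>G\<^esub> H. \<forall>Y\<in>lcosets\<^bsub>G\<^esub> H.
       d (g <#\<^bsub>G\<^esub> X) (g <#\<^bsub>G\<^esub> Y) = d X Y)"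

definition has_proper_invariant_metric ::
    "('a, 'm) monoid_scheme \<Rightarrow> 'a topology \<Rightarrow> 'a set \<Rightarrow> bool"
  where "has_proper_invariant_metric G T H \<longleftrightarrow>
    (\<exists>d. proper_metric (lcosets\<^bsub>G\<^esub> H) d \<and>
         Metric_space.mtopology (lcosets\<^bsub>G\<^esub> H) d = coset_topology G T H \<and>
         invariant_metric G H d)"

text \<open>The map \<open>gH \<mapsto> \<phi>(g)H'\<close>; it is well defined when \<open>\<phi>\<close> is a homomorphism with
  \<open>\<phi>(H) \<subseteq> H'\<close>, see \<open>induced_coset_map_eq\<close> below.\<close>

definition induced_coset_map ::
    "('a, 'm) monoid_scheme \<Rightarrow> 'a set \<Rightarrow> ('b, 'n) monoid_scheme \<Rightarrow> 'b set \<Rightarrow> ('a \<Rightarrow> 'b)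
      \<Rightarrow> 'a set \<Rightarrow> 'b set"
  where "induced_coset_map G H G' H' \<phi> X =
    (THE Y. \<exists>g\<in>carrier G. X = g <#\<^bsub>G\<^esub> H \<and> Y = \<phi> g <#\<^bsub>G'\<^esub> H')"

lemma induced_coset_map_eq:
  assumes "group G" "group G'" "subgroup H G" "subgroup H' G'"
    and \<phi>: "\<phi> \<in> hom G G'" and sub: "\<phi> ` H \<subseteq> H'" and g: "g \<in> carrier G"
  shows "induced_coset_map G H G' H' \<phi> (g <#\<^bsub>G\<^esub> H) = \<phi> g <#\<^bsub>G'\<^esub> H'"
proof -
  interpret G: group G by fact
  interpret G': group G' by fact
  have "\<phi> k <#\<^bsub>G'\<^esub> H' = \<phi> g <#\<^bsub>G'\<^esub> H'"
    if k: "k \<in> carrier G" and eq: "g <#\<^bsub>G\<^esub> H = k <#\<^bsub>G\<^esub> H" for k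
  proof -
    have "k \<in> g <#\<^bsub>G\<^esub> H"
      using G.lcos_self[OF k \<open>subgroup H G\<close>] eq by simp
    then obtain h where h: "h \<in> H" "k = g \<otimes>\<^bsub>G\<^esub> h"
      by (auto simp: l_coset_def)
    then have "\<phi> k = \<phi> g \<otimes>\<^bsub>G'\<^esub> \<phi> h"
      using \<phi> g subgroup.mem_carrier[OF \<open>subgroup H G\<close>] by (simp add: hom_def)
    then have "\<phi> k \<in> \<phi> g <#\<^bsub>G'\<^esub> H'"
      using sub h(1) by (auto simp: l_coset_def)
    then show ?thesis
      using G'.l_repr_independence[of "\<phi> k" "\<phi> g" H'] \<phi> g \<open>subgroup H' G'\<close>
      by (simp add: hom_in_carrier)
  qed
  then show ?thesis
    unfolding induced_coset_map_def using g by (intro the_equality) blast+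
qed

definition proper_homogeneous_model ::
    "('a, 'm) monoid_scheme \<Rightarrow> 'a topology \<Rightarrow> 'a set \<Rightarrow> ('b, 'n) monoid_scheme \<Rightarrow> 'b topology
      \<Rightarrow> 'b set \<Rightarrow> ('a \<Rightarrow> 'b) \<Rightarrow> bool"
  where "proper_homogeneous_model G T H G' T' H' \<phi> \<longleftrightarrow>
    topological_group G' T' \<and> metrizable_space T' \<and> locally_compact_space T' \<and>
    \<phi> \<in> hom G G' \<and> continuous_map T T' \<phi> \<and>
    subgroup H' G' \<and> compactin T' H' \<and>
    \<phi> ` H \<subseteq> H' \<and>
    homeomorphic_map (coset_topology G T H) (coset_topology G' T' H')
      (induced_coset_map G H G' H' \<phi>)"

text \<open>HOL cannot quantify existentially over types. In the existence of \<open>G'\<close> below, its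
  elements are of the type \<open>'a set \<Rightarrow> 'a set\<close> of maps of cosets, whereas the converse
  implication is claimed for \<open>G'\<close> over an arbitrary type \<open>'b\<close>.
  Together this is the equivalence with \<open>G'\<close> ranging over all types.\<close>

end

theory Submission
  imports Defs "HOL-Algebra.Bij"
begin

text \<open>
  Suppose that \<open>G/H\<close> has a proper \<open>G\<close>-invariant metric. Its isometry group \<open>G'\<close>, with the topology of
  pointwise convergence, is a topological group, since the evaluation is jointly continuous on families of
  isometries. It is metrizable, since an isometry is determined by its values on a countable
  dense set, and locally compact, since the isometries that move a point by a bounded amount form a
  compact set (\<open>compactin_isometries_bounded\<close>, by Tychonoff's theorem and properness). The stabilizer \<open>H'\<close>
  of the base point is compact, \<open>G\<close> maps to \<open>G'\<close> by translations, and the induced map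
  \<open>G/H \<rightarrow> G'/H'\<close> is a homeomorphism since evaluation at the base point is a continuous inverse
  (\<open>model_of_proper_invariant_metric\<close>).

  For the converse, Struble's construction of a proper left-invariant metric on a locally compact
  second countable group is carried out modulo the compact subgroup \<open>H'\<close>. There is a family
  \<open>W n\<close>, \<open>n\<close> an integer, of symmetric, relatively compact, open neighbourhoods of \<open>H'\<close> that are invariant
  under \<open>H'\<close> on both sides, such that a product of three elements of \<open>W n\<close> lies in \<open>W (n + 1)\<close>, the
  \<open>W n\<close> for \<open>n\<close> tending to minus infinity shrink to \<open>H'\<close>, and they
  exhaust the image of \<open>G\<close> for \<open>n\<close> tending to infinity (\<open>biinvariant_scale_exists\<close>). The preimages of
  the \<open>W n\<close> in \<open>G\<close> give relations between the points of \<open>G/H\<close> that are invariant under \<open>G\<close>. The distance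
  of two points is the infimum of the costs of the chains between them, where a step in the relation
  number \<open>n\<close> costs \<open>2 powi n\<close>. By the argument of Birkhoff, Kakutani and Frink (\<open>E_of_path\<close>), a distance
  below \<open>2 powi n\<close> implies the relation number \<open>n\<close>. So small balls form a base of the topology and
  every ball is relatively compact, while invariance is built in
  (\<open>has_proper_invariant_metric_of_scale\<close>).
\<close>

section \<open>The chain metric of a dyadic scale of entourages\<close>

lemma power_int_2_arbitrarily_small:
  assumes "(r::real) > 0"
  obtains n :: int where "2 powi n < r"
proof -
  obtain k where "(1/2::real) ^ k < r"
    using real_arch_pow_inv[of r "1/2"] assms by auto
  then have "2 powi (- int k) < r"
    by (simp add: power_int_minus power_one_over inverse_eq_divide)
  then show thesis using that by blast
qed

lemma power_int_2_unbounded: obtains n :: int where "(r::real) < 2 powi n"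
proof -
  obtain k where "r < 2 ^ k" using real_arch_pow[of 2 r] by auto
  then have "r < 2 powi (int k)" by simp
  then show thesis using that by blast
qed

text \<open>
  The hypotheses of the metrization lemma for uniformities, with a scale running over all integers:
  small indices describe the topology and large indices the behaviour at infinity.
  The entourage \<open>E n\<close> is meant to be the relation of being at distance at most about
  \<open>2 powi n\<close>.
\<close>

locale dyadic_scale =
  fixes X :: "'x set" and E :: "int \<Rightarrow> 'x \<Rightarrow> 'x \<Rightarrow> bool"
  assumes E_carrier: "E n x y \<Longrightarrow> x \<in> X \<and> y \<in> X"
    and E_refl: "x \<in> X \<Longrightarrow> E n x x"
    and E_sym: "E n x y \<Longrightarrow> E n y x"
    and E_triple: "E n x y \<Longrightarrow> E n y z \<Longrightarrow> E n z w \<Longrightarrow> E (n + 1) x w"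
    and E_total: "x \<in> X \<Longrightarrow> y \<in> X \<Longrightarrow> \<exists>n. E n x y"
    and E_separated: "x \<in> X \<Longrightarrow> y \<in> X \<Longrightarrow> (\<And>n. E n x y) \<Longrightarrow> x = y"
begin

text \<open>
  \<open>path k x s y\<close>: a chain of \<open>k\<close> steps leads from \<open>x\<close> to \<open>y\<close>, where a step inside \<open>E n\<close> costs
  \<open>2 powi n\<close> and \<open>s\<close> is the total cost. The number of steps is recorded for the induction in
  \<open>E_of_path\<close>.
\<close>

inductive path :: "nat \<Rightarrow> 'x \<Rightarrow> real \<Rightarrow> 'x \<Rightarrow> bool" where
  path_0: "x \<in> X \<Longrightarrow> path 0 x 0 x"
| path_Suc: "path k x s y \<Longrightarrow> E n y z \<Longrightarrow> path (Suc k) x (s + 2 powi n) z"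

lemma path_carrier: "path k x s y \<Longrightarrow> x \<in> X \<and> y \<in> X"
  by (induction rule: path.induct) (auto dest: E_carrier)

lemma path_nonneg: "path k x s y \<Longrightarrow> 0 \<le> s"
  by (induction rule: path.induct) auto

lemma path_append:
  assumes "path l y t z" "path k x s y"
  shows "path (k + l) x (s + t) z"
  using assms
proof (induction arbitrary: k x s rule: path.induct)
  case (path_0 y)
  then show ?case by simp
next
  case (path_Suc l y t z n w)
  then have "path (k + l) x (s + t) z" by blast
  from path.path_Suc[OF this path_Suc.hyps(2)] show ?case
    by (simp add: add.assoc)
qed

lemma path_single: "E n x y \<Longrightarrow> path 1 x (2 powi n) y"
  using path_Suc[OF path_0, of x n y] E_carrier by fastforce

lemma path_sym: "path k x s y \<Longrightarrow> path k y s x"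
proof (induction rule: path.induct)
  case (path_Suc k x s y n z)
  have "path 1 z (2 powi n) y"
    by (rule path_single[OF E_sym[OF path_Suc.hyps(2)]])
  from path_append[OF path_Suc.IH this] show ?case
    by (simp add: add.commute)
qed (rule path.path_0)

text \<open>
  The step at which the accumulated cost first reaches \<open>t1\<close> splits the chain: what precedes it costs
  less than \<open>t1\<close>, and what follows costs less than \<open>t2\<close>, as the total is below \<open>t1 + t2\<close>.
  The induction adds steps at the end, so the second threshold has to vary.
\<close>

lemma path_split:
  assumes "path k x s y" and "0 < k" and "s < t1 + t2" and "0 < t1" and "0 < t2"
  shows "\<exists>k1 k2 s1 s2 u n v. path k1 x s1 u \<and> E n u v \<and> path k2 v s2 y \<and>
    k1 < k \<and> k2 < k \<and> s1 < t1 \<and> s2 < t2 \<and> s = s1 + 2 powi n + s2"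
  using assms
proof (induction arbitrary: t2 rule: path.induct)
  case (path_Suc k x s y n z)
  have z: "path 0 z 0 z"
    using path_Suc.hyps(2) E_carrier path_0 by blast
  show ?case
  proof (cases "s < t1")
    case True
    show ?thesis
      by (rule exI[of _ k], rule exI[of _ 0], rule exI[of _ s], rule exI[of _ 0],
          rule exI[of _ y], rule exI[of _ n], rule exI[of _ z])
        (use True z path_Suc in auto)
  next
    case False
    then have "0 < k"
      using path_Suc.hyps(1) path_Suc.prems by (cases k) (auto elim: path.cases)
    moreover have "s < t1 + (t2 - 2 powi n)" "0 < t2 - 2 powi n"
      using path_Suc.prems False by auto
    ultimately obtain k1 k2 s1 s2 u m v where 1: "path k1 x s1 u" "E m u v" "path k2 v s2 y"
      "k1 < k" "k2 < k" "s1 < t1" "s2 < t2 - 2 powi n" "s = s1 + 2 powi m + s2"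
      using path_Suc.IH path_Suc.prems by blast
    have "path (Suc k2) v (s2 + 2 powi n) z"
      using 1 path_Suc.hyps by (auto intro: path.path_Suc)
    then show ?thesis
      using 1 by (intro exI[of _ k1] exI[of _ "Suc k2"] exI[of _ s1] exI[of _ "s2 + 2 powi n"]
        exI[of _ u] exI[of _ m] exI[of _ v]) auto
  qed
qed auto

lemma E_mono_Suc: "E n x y \<Longrightarrow> E (n + 1) x y"
  using E_triple E_refl E_carrier by blast

lemma E_mono:
  assumes "m \<le> n" "E m x y" shows "E n x y"
  using assms by (induction n rule: int_ge_induct) (auto intro: E_mono_Suc)

text \<open>
  Frink's argument. A chain of cost below \<open>2 powi n\<close> splits into a first part of cost below
  \<open>2 powi (n - 1)\<close>, one step, and a last part of cost below \<open>2 powi (n - 1)\<close>. The two parts lie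
  in \<open>E (n - 1)\<close> by induction, the step does because its own cost is below \<open>2 powi n\<close>, and three
  relations in \<open>E (n - 1)\<close> compose to one in \<open>E n\<close>.
\<close>

lemma E_of_path: "path k x s y \<Longrightarrow> s < 2 powi n \<Longrightarrow> E n x y"
proof (induction k arbitrary: x s y n rule: less_induct)
  case (less k)
  show ?case
  proof (cases "k = 0")
    case True
    then have "x = y" "x \<in> X"
      using less.prems(1) by (auto elim: path.cases)
    then show ?thesis using E_refl by simp
  next
    case False
    have half: "2 powi n = 2 powi (n - 1) + (2::real) powi (n - 1)"
      by (simp add: power_int_diff)
    obtain k1 k2 s1 s2 u m v where 1: "path k1 x s1 u" "E m u v" "path k2 v s2 y"
      "k1 < k" "k2 < k" "s1 < 2 powi (n - 1)" "s2 < 2 powi (n - 1)" "s = s1 + 2 powi m + s2"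
      using path_split[OF less.prems(1), of "2 powi (n - 1)" "2 powi (n - 1)"] False
        less.prems(2) half by auto
    have "(2::real) powi m < 2 powi n"
      using 1 path_nonneg[OF 1(1)] path_nonneg[OF 1(3)] less.prems(2) by linarith
    then have "m \<le> n - 1"
      by (smt (verit, best) power_int_increasing)
    then have "E (n - 1) u v" using 1 E_mono by blast
    moreover have "E (n - 1) x u" "E (n - 1) v y"
      using less.IH 1 by blast+
    ultimately have "E (n - 1 + 1) x y" using E_triple by blast
    then show ?thesis by simp
  qed
qed

text \<open>
  The value \<open>0\<close> outside of \<open>X\<close> is there because a \<open>Metric_space\<close> has to be non-negative and
  symmetric on the whole type.
\<close>

definition chain_dist :: "'x \<Rightarrow> 'x \<Rightarrow> real" where
  "chain_dist x y = (if x \<in> X \<and> y \<in> X then Inf {s. \<exists>k. path k x s y} else 0)"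

lemma path_lengths_bdd_below: "bdd_below {s. \<exists>k. path k x s y}"
  using path_nonneg by (auto intro: bdd_belowI[of _ 0])

lemma path_exists: "x \<in> X \<Longrightarrow> y \<in> X \<Longrightarrow> \<exists>k s. path k x s y"
  using E_total path_single by blast

lemma chain_dist_le: "path k x s y \<Longrightarrow> chain_dist x y \<le> s"
  unfolding chain_dist_def using path_carrier path_lengths_bdd_below
  by (auto intro!: cInf_lower)

lemma chain_dist_less:
  assumes "x \<in> X" "y \<in> X" "chain_dist x y < r"
  obtains k s where "path k x s y" "s < r"
proof -
  have "{s. \<exists>k. path k x s y} \<noteq> {}" using path_exists[OF assms(1,2)] by auto
  with assms show thesis
    using that cInf_lessD[of "{s. \<exists>k. path k x s y}" r] unfolding chain_dist_def by auto
qed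

lemma chain_dist_le_of_E: "E n x y \<Longrightarrow> chain_dist x y \<le> 2 powi n"
  using path_single chain_dist_le by blast

lemma E_of_chain_dist: "x \<in> X \<Longrightarrow> y \<in> X \<Longrightarrow> chain_dist x y < 2 powi n \<Longrightarrow> E n x y"
  by (meson chain_dist_less E_of_path)

lemma chain_dist_nonneg: "0 \<le> chain_dist x y"
proof (cases "x \<in> X \<and> y \<in> X")
  case True
  then have "{s. \<exists>k. path k x s y} \<noteq> {}" using path_exists[of x y] by auto
  then show ?thesis
    unfolding chain_dist_def using path_nonneg by (auto intro!: cInf_greatest)
qed (auto simp: chain_dist_def)

sublocale chain: Metric_space X chain_dist
proof
  fix x y
  show "0 \<le> chain_dist x y" by (rule chain_dist_nonneg)
  have "{s. \<exists>k. path k x s y} = {s. \<exists>k. path k y s x}" using path_sym by blast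
  then show "chain_dist x y = chain_dist y x" unfolding chain_dist_def by auto
next
  fix x y assume xy: "x \<in> X" "y \<in> X"
  show "chain_dist x y = 0 \<longleftrightarrow> x = y"
  proof
    assume 0: "chain_dist x y = 0"
    show "x = y"
      by (rule E_separated[OF xy]) (rule E_of_chain_dist[OF xy], simp add: 0)
  next
    assume "x = y"
    then have "path 0 x 0 y" using xy path_0 by simp
    then show "chain_dist x y = 0"
      using chain_dist_le chain_dist_nonneg by (metis order_antisym)
  qed
next
  fix x y z assume xyz: "x \<in> X" "y \<in> X" "z \<in> X"
  show "chain_dist x z \<le> chain_dist x y + chain_dist y z"
  proof (rule field_le_epsilon)
    fix e :: real assume e: "e > 0"
    have "chain_dist x y < chain_dist x y + e/2" "chain_dist y z < chain_dist y z + e/2" using e by auto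
    then obtain k s l t where "path k x s y" "s < chain_dist x y + e/2"
      "path l y t z" "t < chain_dist y z + e/2"
      by (metis chain_dist_less xyz)
    then show "chain_dist x z \<le> chain_dist x y + chain_dist y z + e"
      using chain_dist_le[OF path_append] by fastforce
  qed
qed

lemma openin_chain_dist:
  "openin chain.mtopology U \<longleftrightarrow> U \<subseteq> X \<and> (\<forall>x\<in>U. \<exists>n. \<forall>y. E n x y \<longrightarrow> y \<in> U)"
  unfolding chain.openin_mtopology
proof (intro conj_cong refl iffI ballI allI impI)
  fix x assume U: "U \<subseteq> X" and x: "x \<in> U" and *: "\<forall>x. x \<in> U \<longrightarrow> (\<exists>r>0. chain.mball x r \<subseteq> U)"
  then obtain r where r: "r > 0" "chain.mball x r \<subseteq> U" by blast
  obtain n where n: "2 powi n < r" using power_int_2_arbitrarily_small r by blast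
  then have "y \<in> U" if "E n x y" for y
    using chain_dist_le_of_E[OF that] E_carrier[OF that] r by auto
  then show "\<exists>n. \<forall>y. E n x y \<longrightarrow> y \<in> U" by blast
next
  fix x assume U: "U \<subseteq> X" and *: "\<forall>x\<in>U. \<exists>n. \<forall>y. E n x y \<longrightarrow> y \<in> U" and x: "x \<in> U"
  then obtain n where "\<forall>y. E n x y \<longrightarrow> y \<in> U" by blast
  then have "chain.mball x (2 powi n) \<subseteq> U" using E_of_chain_dist by auto
  then show "\<exists>r>0. chain.mball x r \<subseteq> U" by (intro exI[of _ "2 powi n"]) auto
qed

lemma mcball_chain_dist_subset: "\<exists>n. chain.mcball x r \<subseteq> {y. E n x y}"
proof -
  obtain n :: int where "r < 2 powi n" by (rule power_int_2_unbounded)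
  then show ?thesis using E_of_chain_dist by (intro exI[of _ n]) auto
qed

text \<open>
  The chain distance depends only on the entourages, so a map that respects them cannot increase it.
  For a group of such maps this gives invariance.
\<close>

lemma chain_dist_contraction:
  assumes \<sigma>: "\<And>n x y. E n x y \<Longrightarrow> E n (\<sigma> x) (\<sigma> y)" and xy: "x \<in> X" "y \<in> X"
  shows "chain_dist (\<sigma> x) (\<sigma> y) \<le> chain_dist x y"
proof (rule field_le_epsilon)
  have path: "path k (\<sigma> x) s (\<sigma> y)" if "path k x s y" for k x s y
    using that
  proof (induction rule: path.induct)
    case (path_0 x)
    then show ?case using \<sigma>[OF E_refl] E_carrier path.path_0 by blast
  qed (auto intro: path.path_Suc \<sigma>)
  fix e :: real assume "e > 0"
  then obtain k s where "path k x s y" "s < chain_dist x y + e"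
    using chain_dist_less[OF xy, of "chain_dist x y + e"] by auto
  then show "chain_dist (\<sigma> x) (\<sigma> y) \<le> chain_dist x y + e"
    using chain_dist_le[OF path] by fastforce
qed

end

section \<open>Invariant metrics on coset spaces\<close>

lemma (in group) l_coset_eq_iff:
  assumes H: "subgroup H G" and g: "g \<in> carrier G" and k: "k \<in> carrier G"
  shows "g <# H = k <# H \<longleftrightarrow> inv g \<otimes> k \<in> H"
proof
  assume "g <# H = k <# H"
  then have "k \<in> g <# H" using lcos_self[OF k H] by simp
  then show "inv g \<otimes> k \<in> H" using subgroup.lcos_module_imp[OF H is_group g] by simp
next
  assume "inv g \<otimes> k \<in> H"
  then have "k \<in> g <# H"
    using g k by (auto simp: l_coset_def m_assoc[symmetric] intro!: bexI[of _ "inv g \<otimes> k"])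
  then show "g <# H = k <# H" using l_repr_independence[OF _ g H] by simp
qed

lemma (in group) l_coset_l_coset:
  "subgroup H G \<Longrightarrow> g \<in> carrier G \<Longrightarrow> k \<in> carrier G \<Longrightarrow> g <# (k <# H) = (g \<otimes> k) <# H"
  using lcos_m_assoc subgroup.subset by blast

lemma (in group) l_coset_subgroup: "subgroup H G \<Longrightarrow> \<one> <# H = H"
  using lcos_mult_one subgroup.subset by blast

lemma (in group) l_coset_in_lcosets [simp]: "g \<in> carrier G \<Longrightarrow> g <# H \<in> lcosets H"
  by (auto simp: LCOSETS_def)

lemma (in group) lcosetsE:
  assumes "X \<in> lcosets H" obtains g where "g \<in> carrier G" "X = g <# H"
  using assms by (auto simp: LCOSETS_def)

lemma (in group) translate_in_lcosets:
  "subgroup H G \<Longrightarrow> g \<in> carrier G \<Longrightarrow> X \<in> lcosets H \<Longrightarrow> g <# X \<in> lcosets H"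
  by (auto elim!: lcosetsE simp: l_coset_l_coset)

context topological_group
begin

lemma continuous_map_mult:
  assumes "continuous_map Z T f" "continuous_map Z T g"
  shows "continuous_map Z T (\<lambda>z. f z \<otimes> g z)"
proof -
  have "continuous_map Z (prod_topology T T) (\<lambda>z. (f z, g z))"
    using assms by (simp add: continuous_map_pairedI)
  from continuous_map_compose[OF this continuous_mult] show ?thesis
    by (simp add: o_def)
qed

lemma continuous_map_left_translation:
  "g \<in> carrier G \<Longrightarrow> continuous_map T T (\<lambda>x. g \<otimes> x)"
  by (intro continuous_map_mult) (auto simp: topspace_eq)

lemma continuous_map_right_translation:
  "g \<in> carrier G \<Longrightarrow> continuous_map T T (\<lambda>x. x \<otimes> g)"
  by (intro continuous_map_mult) (auto simp: topspace_eq)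

lemma openin_carrier: "openin T U \<Longrightarrow> u \<in> U \<Longrightarrow> u \<in> carrier G"
  using openin_subset topspace_eq by blast

lemma compactin_carrier: "compactin T K \<Longrightarrow> u \<in> K \<Longrightarrow> u \<in> carrier G"
  using compactin_subset_topspace topspace_eq by blast

lemma openin_left_translate:
  assumes "openin T U" "g \<in> carrier G" shows "openin T {x \<in> carrier G. g \<otimes> x \<in> U}"
  using openin_continuous_map_preimage[OF continuous_map_left_translation assms(1)] assms(2)
  by (simp add: topspace_eq)

lemma openin_right_translate:
  assumes "openin T U" "g \<in> carrier G" shows "openin T {x \<in> carrier G. x \<otimes> g \<in> U}"
  using openin_continuous_map_preimage[OF continuous_map_right_translation assms(1)] assms(2)
  by (simp add: topspace_eq)

lemma openin_inverse:
  assumes "openin T U" shows "openin T {x \<in> carrier G. inv x \<in> U}"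
  using openin_continuous_map_preimage[OF continuous_inv assms] by (simp add: topspace_eq)

lemma continuous_map_coset_projection:
  "continuous_map T (coset_topology G T H) (\<lambda>g. g <# H)"
  using quotient_map_coset_topology quotient_imp_continuous_map by blast

lemma continuous_map_from_coset_topology:
  assumes "continuous_map T Z (\<lambda>g. f (g <# H))"
  shows "continuous_map (coset_topology G T H) Z f"
  using continuous_compose_quotient_map[OF quotient_map_coset_topology, of Z f H] assms
  by (simp add: o_def)

text \<open>
  The saturation of an open set \<open>U\<close> consists of the \<open>g\<close> with \<open>g \<otimes> h \<in> U\<close> for some \<open>h \<in> H\<close>,
  and so is a union of right translates of \<open>U\<close>.
\<close>

lemma open_map_coset_projection:
  assumes H: "subgroup H G"
  shows "open_map T (coset_topology G T H) (\<lambda>g. g <# H)"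
  unfolding open_map_def openin_coset_topology topspace_eq
proof (intro allI impI conjI)
  fix U assume U: "openin T U"
  show "(\<lambda>g. g <# H) ` U \<subseteq> lcosets H" using openin_carrier[OF U] by auto
  have "{g \<in> carrier G. g <# H \<in> (\<lambda>g. g <# H) ` U} = (\<Union>h\<in>H. {g \<in> carrier G. g \<otimes> h \<in> U})"
  proof (intro subset_antisym subsetI)
    fix g assume "g \<in> {g \<in> carrier G. g <# H \<in> (\<lambda>g. g <# H) ` U}"
    then obtain u where u: "u \<in> U" "g \<in> carrier G" "g <# H = u <# H" by auto
    then have "u \<in> carrier G" using openin_carrier[OF U] by blast
    then have "inv g \<otimes> u \<in> H" "g \<otimes> (inv g \<otimes> u) = u"
      using u l_coset_eq_iff[OF H] by (auto simp: m_assoc[symmetric])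
    then show "g \<in> (\<Union>h\<in>H. {g \<in> carrier G. g \<otimes> h \<in> U})" using u by force
  next
    fix g assume "g \<in> (\<Union>h\<in>H. {g \<in> carrier G. g \<otimes> h \<in> U})"
    then obtain h where h: "h \<in> H" "g \<in> carrier G" "g \<otimes> h \<in> U" by auto
    then have hc: "h \<in> carrier G" using H subgroup.mem_carrier by metis
    have "g <# H = (g \<otimes> h) <# H"
      using h hc by (simp add: l_coset_eq_iff[OF H] m_assoc[symmetric])
    then show "g \<in> {g \<in> carrier G. g <# H \<in> (\<lambda>g. g <# H) ` U}" using h by auto
  qed
  moreover have "openin T (\<Union>h\<in>H. {g \<in> carrier G. g \<otimes> h \<in> U})"
    using openin_right_translate[OF U] subgroup.mem_carrier[OF H] by auto
  ultimately show "openin T {g \<in> carrier G. g <# H \<in> (\<lambda>g. g <# H) ` U}" by simp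
qed

lemma second_countable_coset_topology:
  assumes "subgroup H G" "second_countable T"
  shows "second_countable (coset_topology G T H)"
  by (rule second_countable_open_map_image[OF continuous_map_coset_projection[of H]
        open_map_coset_projection[OF assms(1)] _ assms(2)])
    (auto simp: topspace_coset_topology topspace_eq LCOSETS_def)

lemma continuous_map_coset_translation:
  assumes H: "subgroup H G" and g: "g \<in> carrier G"
  shows "continuous_map (coset_topology G T H) (coset_topology G T H) (\<lambda>X. g <# X)"
proof (rule continuous_map_from_coset_topology)
  have "continuous_map T (coset_topology G T H) (\<lambda>x. (g \<otimes> x) <# H)"
    using continuous_map_compose[OF continuous_map_left_translation[OF g]
        continuous_map_coset_projection[of H]] by (simp add: o_def)
  then show "continuous_map T (coset_topology G T H) (\<lambda>x. g <# (x <# H))"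
    by (rule continuous_map_eq) (auto simp: topspace_eq l_coset_l_coset[OF H g])
qed

text \<open>
  A scale of bi-invariant neighbourhoods \<open>A n\<close> of \<open>H\<close> gives the entourages
  \<open>inv g \<otimes> k \<in> A n\<close> between \<open>g <# H\<close> and \<open>k <# H\<close>, which left translations preserve;
  bi-invariance under \<open>H\<close> makes them independent of the representatives. The chain metric of this
  dyadic scale is therefore invariant. It induces the coset topology because the \<open>A n\<close> form a base at
  the coset \<open>H\<close>, and it is proper because they are relatively compact modulo \<open>H\<close>.
\<close>

lemma has_proper_invariant_metric_of_scale:
  fixes A :: "int \<Rightarrow> 'a set"
  assumes H: "subgroup H G" and closed: "closedin T H"
    and op: "\<And>n. openin T (A n)"
    and inverse: "\<And>n a. a \<in> A n \<Longrightarrow> inv a \<in> A n"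
    and sub: "\<And>n. H \<subseteq> A n"
    and biinv: "\<And>n a h k. a \<in> A n \<Longrightarrow> h \<in> H \<Longrightarrow> k \<in> H \<Longrightarrow> h \<otimes> a \<otimes> k \<in> A n"
    and triple: "\<And>n a b c. a \<in> A n \<Longrightarrow> b \<in> A n \<Longrightarrow> c \<in> A n \<Longrightarrow> a \<otimes> b \<otimes> c \<in> A (n + 1)"
    and cover: "\<And>g. g \<in> carrier G \<Longrightarrow> \<exists>n. g \<in> A n"
    and base: "\<And>U. openin (coset_topology G T H) U \<Longrightarrow> H \<in> U \<Longrightarrow> \<exists>n. \<forall>a\<in>A n. a <# H \<in> U"
    and relcompact: "\<And>n. \<exists>C. compactin (coset_topology G T H) C \<and> (\<forall>a\<in>A n. a <# H \<in> C)"
  shows "has_proper_invariant_metric G T H"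
proof -
  define E where "E n X Y \<longleftrightarrow> (\<exists>g\<in>carrier G. \<exists>a\<in>A n. X = g <# H \<and> Y = (g \<otimes> a) <# H)" for n X Y
  have Ac: "a \<in> carrier G" if "a \<in> A n" for a n using openin_carrier[OF op] that by blast
  have E_iff: "E n (g <# H) (k <# H) \<longleftrightarrow> inv g \<otimes> k \<in> A n"
    if g: "g \<in> carrier G" and k: "k \<in> carrier G" for g k n
  proof
    assume "E n (g <# H) (k <# H)"
    then obtain g' a where 1: "g' \<in> carrier G" "a \<in> A n" "g <# H = g' <# H" "k <# H = (g' \<otimes> a) <# H"
      unfolding E_def by blast
    have a: "a \<in> carrier G" using Ac 1 by blast
    have h: "inv g \<otimes> g' \<in> H" "inv (g' \<otimes> a) \<otimes> k \<in> H"
      using 1 g k a l_coset_eq_iff[OF H] by (metis m_closed)+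
    have "inv g \<otimes> g' \<otimes> a \<otimes> (inv (g' \<otimes> a) \<otimes> k) \<in> A n"
      using biinv[OF 1(2) h] .
    moreover have "inv g \<otimes> g' \<otimes> a \<otimes> (inv (g' \<otimes> a) \<otimes> k) = inv g \<otimes> ((g' \<otimes> a) \<otimes> inv (g' \<otimes> a)) \<otimes> k"
      using 1 g k a by (simp only: m_assoc m_closed inv_closed)
    ultimately show "inv g \<otimes> k \<in> A n" using 1 g k a by simp
  next
    assume *: "inv g \<otimes> k \<in> A n"
    have "k = g \<otimes> (inv g \<otimes> k)" using g k by (simp add: m_assoc[symmetric])
    then show "E n (g <# H) (k <# H)" unfolding E_def using g * by metis
  qed
  have E_carrier: "X \<in> lcosets H \<and> Y \<in> lcosets H" if "E n X Y" for n X Y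
    using that Ac unfolding E_def by auto
  have one: "\<one> \<in> A n" for n using sub subgroup.one_closed[OF H] by blast
  interpret dyadic_scale "lcosets H" E
  proof
    show "X \<in> lcosets H \<and> Y \<in> lcosets H" if "E n X Y" for n X Y using E_carrier that .
    show "E n X X" if "X \<in> lcosets H" for n X
      using that one by (auto elim!: lcosetsE simp: E_iff)
    show "E n Y X" if XY: "E n X Y" for n X Y
    proof -
      obtain g k where gk: "g \<in> carrier G" "k \<in> carrier G" "X = g <# H" "Y = k <# H"
        using E_carrier[OF XY] by (metis lcosetsE)
      then have "inv g \<otimes> k \<in> A n" using XY E_iff by simp
      then have "inv (inv g \<otimes> k) \<in> A n" by (rule inverse)
      then show ?thesis using gk by (simp add: E_iff inv_mult_group)
    qed
    show "E (n + 1) X W" if XY: "E n X Y" and YZ: "E n Y Z" and ZW: "E n Z W" for n X Y Z W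
    proof -
      obtain a b c d where g: "a \<in> carrier G" "b \<in> carrier G" "c \<in> carrier G" "d \<in> carrier G"
        "X = a <# H" "Y = b <# H" "Z = c <# H" "W = d <# H"
        using E_carrier[OF XY] E_carrier[OF ZW] by (metis lcosetsE)
      then have "inv a \<otimes> b \<in> A n" "inv b \<otimes> c \<in> A n" "inv c \<otimes> d \<in> A n"
        using XY YZ ZW by (simp_all add: E_iff)
      then have "(inv a \<otimes> b) \<otimes> (inv b \<otimes> c) \<otimes> (inv c \<otimes> d) \<in> A (n + 1)" by (rule triple)
      moreover have "(inv a \<otimes> b) \<otimes> (inv b \<otimes> c) \<otimes> (inv c \<otimes> d)
        = inv a \<otimes> (b \<otimes> inv b) \<otimes> (c \<otimes> inv c) \<otimes> d"
        using g by (simp only: m_assoc m_closed inv_closed)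
      ultimately show ?thesis using g by (simp add: E_iff)
    qed
    show "\<exists>n. E n X Y" if "X \<in> lcosets H" "Y \<in> lcosets H" for X Y
      using that cover by (auto elim!: lcosetsE simp: E_iff)
    show "X = Y" if XY: "X \<in> lcosets H" "Y \<in> lcosets H" and E: "\<And>n. E n X Y" for X Y
    proof -
      obtain g k where gk: "g \<in> carrier G" "k \<in> carrier G" "X = g <# H" "Y = k <# H"
        using XY by (metis lcosetsE)
      define c where "c = inv g \<otimes> k"
      have c: "c \<in> carrier G" "c \<in> A n" for n using E gk by (auto simp: E_iff c_def)
      \<comment> \<open>If \<open>c\<close> were outside of \<open>H\<close>, the complement of the point \<open>c <# H\<close> would be a
        neighbourhood of \<open>H\<close> in the coset space, open because \<open>H\<close> is closed, and the base would
        provide an \<open>A n\<close> without \<open>c\<close>.\<close>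
      have "c \<in> H"
      proof (rule ccontr)
        assume "c \<notin> H"
        have eq: "{x \<in> carrier G. x <# H \<noteq> c <# H} = {x \<in> carrier G. inv c \<otimes> x \<in> carrier G - H}"
          using c l_coset_eq_iff[OF H c(1)] by auto
        have "openin (coset_topology G T H) (lcosets H - {c <# H})"
          unfolding openin_coset_topology
        proof
          have "openin T (carrier G - H)" using closed topspace_eq closedin_def by metis
          then have "openin T {x \<in> carrier G. x <# H \<noteq> c <# H}"
            unfolding eq by (rule openin_left_translate) (use c in simp)
          moreover have "{x \<in> topspace T. x <# H \<in> lcosets H - {c <# H}} = {x \<in> carrier G. x <# H \<noteq> c <# H}"
            by (auto simp: topspace_eq)
          ultimately show "openin T {x \<in> topspace T. x <# H \<in> lcosets H - {c <# H}}" by simp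
        qed auto
        moreover have "H \<in> lcosets H - {c <# H}"
          using l_coset_eq_iff[OF H one_closed c(1)] \<open>c \<notin> H\<close> c l_coset_subgroup[OF H]
            l_coset_in_lcosets[OF one_closed, of H] by auto
        ultimately obtain n where "\<forall>a\<in>A n. a <# H \<in> lcosets H - {c <# H}" using base by blast
        then show False using c(2)[of n] by auto
      qed
      then show ?thesis using gk l_coset_eq_iff[OF H gk(1,2)] c_def by simp
    qed
  qed
  have ball_eq: "{Y. E n (g <# H) Y} = (\<lambda>X. g <# X) ` (\<lambda>a. a <# H) ` A n" if g: "g \<in> carrier G" for g n
  proof -
    have "E n (g <# H) Y \<longleftrightarrow> (\<exists>a\<in>A n. Y = (g \<otimes> a) <# H)" for Y
    proof
      assume EY: "E n (g <# H) Y"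
      then obtain k where k: "k \<in> carrier G" "Y = k <# H" using E_carrier by (metis lcosetsE)
      then have "inv g \<otimes> k \<in> A n" "k = g \<otimes> (inv g \<otimes> k)"
        using EY g by (auto simp: E_iff m_assoc[symmetric])
      then show "\<exists>a\<in>A n. Y = (g \<otimes> a) <# H" using k by metis
    qed (use g in \<open>auto simp: E_def\<close>)
    moreover have "g <# (a <# H) = (g \<otimes> a) <# H" if "a \<in> A n" for a
      using l_coset_l_coset[OF H g] Ac that by blast
    ultimately show ?thesis by (auto simp: image_image)
  qed
  have top: "chain.mtopology = coset_topology G T H"
    unfolding topology_eq openin_chain_dist
  proof (intro allI iffI)
    fix U assume U: "U \<subseteq> lcosets H \<and> (\<forall>X\<in>U. \<exists>n. \<forall>Y. E n X Y \<longrightarrow> Y \<in> U)"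
    show "openin (coset_topology G T H) U"
      unfolding openin_coset_topology
    proof
      show "openin T {g \<in> topspace T. g <# H \<in> U}"
      proof (subst openin_subopen, safe)
        fix g assume g: "g \<in> topspace T" "g <# H \<in> U"
        then have gc: "g \<in> carrier G" by (simp add: topspace_eq)
        obtain n where n: "\<forall>Y. E n (g <# H) Y \<longrightarrow> Y \<in> U" using U g by blast
        show "\<exists>V. openin T V \<and> g \<in> V \<and> V \<subseteq> {g \<in> topspace T. g <# H \<in> U}"
        proof (intro exI conjI)
          show "openin T {x \<in> carrier G. inv g \<otimes> x \<in> A n}"
            using openin_left_translate[OF op] gc by simp
          show "g \<in> {x \<in> carrier G. inv g \<otimes> x \<in> A n}" using gc one by simp
          show "{x \<in> carrier G. inv g \<otimes> x \<in> A n} \<subseteq> {g \<in> topspace T. g <# H \<in> U}"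
            using n gc by (auto simp: topspace_eq E_iff)
        qed
      qed
    qed (use U in blast)
  next
    fix U assume U: "openin (coset_topology G T H) U"
    show "U \<subseteq> lcosets H \<and> (\<forall>X\<in>U. \<exists>n. \<forall>Y. E n X Y \<longrightarrow> Y \<in> U)"
    proof (intro conjI ballI)
      show sub: "U \<subseteq> lcosets H" using U openin_coset_topology by metis
      fix X assume X: "X \<in> U"
      then obtain g where g: "g \<in> carrier G" "X = g <# H" using sub by (auto elim: lcosetsE)
      have "openin (coset_topology G T H) {Y \<in> lcosets H. g <# Y \<in> U}"
        using openin_continuous_map_preimage[OF continuous_map_coset_translation[OF H g(1)] U]
        by (simp add: topspace_coset_topology)
      moreover have "H \<in> {Y \<in> lcosets H. g <# Y \<in> U}"
        using X g l_coset_subgroup[OF H] l_coset_in_lcosets[OF one_closed, of H] by simp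
      ultimately obtain n where "\<forall>a\<in>A n. a <# H \<in> {Y \<in> lcosets H. g <# Y \<in> U}" using base by blast
      then have "{Y. E n X Y} \<subseteq> U" using ball_eq[OF g(1)] g(2) by auto
      then show "\<exists>n. \<forall>Y. E n X Y \<longrightarrow> Y \<in> U" by blast
    qed
  qed
  have "compactin chain.mtopology (chain.mcball X r)" if X: "X \<in> lcosets H" for X r
  proof -
    obtain n where n: "chain.mcball X r \<subseteq> {Y. E n X Y}" using mcball_chain_dist_subset by blast
    obtain g where g: "g \<in> carrier G" "X = g <# H" using X by (rule lcosetsE)
    obtain C where C: "compactin (coset_topology G T H) C" "\<forall>a\<in>A n. a <# H \<in> C" using relcompact by blast
    have "compactin (coset_topology G T H) ((\<lambda>X. g <# X) ` C)"
      using image_compactin[OF C(1) continuous_map_coset_translation[OF H g(1)]] .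
    moreover have "chain.mcball X r \<subseteq> (\<lambda>X. g <# X) ` C"
      using n C(2) unfolding g(2) ball_eq[OF g(1)] by auto
    ultimately show ?thesis
      using chain.closedin_mcball closed_compactin unfolding top by metis
  qed
  then have "proper_metric (lcosets H) chain_dist"
    unfolding proper_metric_def using chain.Metric_space_axioms by blast
  moreover have "invariant_metric G H chain_dist"
    unfolding invariant_metric_def
  proof (intro ballI)
    fix g X Y assume g: "g \<in> carrier G" and XY: "X \<in> lcosets H" "Y \<in> lcosets H"
    have E_translate: "E n (k <# X) (k <# Y)" if k: "k \<in> carrier G" and E: "E n X Y" for k n X Y
    proof -
      obtain g a where 1: "g \<in> carrier G" "a \<in> A n" "X = g <# H" "Y = (g \<otimes> a) <# H"
        using E unfolding E_def by blast
      then have "k <# X = (k \<otimes> g) <# H" "k <# Y = (k \<otimes> g \<otimes> a) <# H"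
        using k Ac[OF 1(2)] by (simp_all add: l_coset_l_coset[OF H] m_assoc)
      then show ?thesis unfolding E_def using 1 k by blast
    qed
    have le: "chain_dist (k <# X) (k <# Y) \<le> chain_dist X Y"
      if "k \<in> carrier G" "X \<in> lcosets H" "Y \<in> lcosets H" for k X Y
      by (rule chain_dist_contraction) (use that E_translate in simp_all)
    have "inv g <# (g <# Z) = Z" if Z: "Z \<in> lcosets H" for Z
    proof -
      obtain k where k: "k \<in> carrier G" "Z = k <# H" by (rule lcosetsE[OF Z])
      have "inv g \<otimes> (g \<otimes> k) = k" using g k(1) by (simp add: m_assoc[symmetric])
      then show ?thesis using g k by (simp add: l_coset_l_coset[OF H])
    qed
    then show "chain_dist (g <# X) (g <# Y) = chain_dist X Y"
      using le[OF g XY] le[of "inv g" "g <# X" "g <# Y"] g XY translate_in_lcosets[OF H g]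
      by (simp add: order_antisym)
  qed
  ultimately show ?thesis
    unfolding has_proper_invariant_metric_def using top by blast
qed

end

section \<open>Scales of bi-invariant neighbourhoods of a compact subgroup\<close>

context topological_group
begin

definition biinvariant_nbhd :: "'a set \<Rightarrow> 'a set \<Rightarrow> bool" where
  "biinvariant_nbhd K W \<longleftrightarrow> openin T W \<and> K \<subseteq> W \<and> (\<forall>w\<in>W. inv w \<in> W) \<and>
     (\<forall>w\<in>W. \<forall>h\<in>K. \<forall>k\<in>K. h \<otimes> w \<otimes> k \<in> W)"

definition relatively_compact :: "'a set \<Rightarrow> bool" where
  "relatively_compact W \<longleftrightarrow> (\<exists>C. compactin T C \<and> W \<subseteq> C)"

lemma compactin_set_mult:
  assumes A: "compactin T A" and B: "compactin T B"
  shows "compactin T (A <#> B)"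
proof -
  have "compactin (prod_topology T T) (A \<times> B)" using A B by (simp add: compactin_Times)
  moreover have "A <#> B = (\<lambda>(x, y). x \<otimes> y) ` (A \<times> B)" by (auto simp: set_mult_def)
  ultimately show ?thesis using image_compactin continuous_mult by metis
qed

lemma compactin_set_inv: "compactin T A \<Longrightarrow> compactin T ((\<lambda>x. inv x) ` A)"
  using image_compactin continuous_inv by blast

lemma openin_set_mult_left:
  assumes A: "A \<subseteq> carrier G" and U: "openin T U"
  shows "openin T (A <#> U)"
proof -
  have "A <#> U = (\<Union>a\<in>A. {x \<in> carrier G. inv a \<otimes> x \<in> U})"
  proof (intro subset_antisym subsetI)
    fix x assume "x \<in> A <#> U"
    then obtain a u where au: "a \<in> A" "u \<in> U" "x = a \<otimes> u" by (auto simp: set_mult_def)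
    then have "a \<in> carrier G" "u \<in> carrier G" using A openin_carrier[OF U] by auto
    then show "x \<in> (\<Union>a\<in>A. {x \<in> carrier G. inv a \<otimes> x \<in> U})"
      using au by (auto simp: m_assoc[symmetric] intro!: bexI[of _ a])
  next
    fix x assume "x \<in> (\<Union>a\<in>A. {x \<in> carrier G. inv a \<otimes> x \<in> U})"
    then obtain a where a: "a \<in> A" "x \<in> carrier G" "inv a \<otimes> x \<in> U" by auto
    then have "x = a \<otimes> (inv a \<otimes> x)" using A by (auto simp: m_assoc[symmetric])
    then show "x \<in> A <#> U" using a unfolding set_mult_def by blast
  qed
  moreover have "openin T (\<Union>a\<in>A. {x \<in> carrier G. inv a \<otimes> x \<in> U})"
    using A by (intro openin_Union ballI) (auto intro!: openin_left_translate[OF U])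
  ultimately show ?thesis by simp
qed

lemma openin_set_mult_right:
  assumes A: "A \<subseteq> carrier G" and U: "openin T U"
  shows "openin T (U <#> A)"
proof -
  have "U <#> A = (\<Union>a\<in>A. {x \<in> carrier G. x \<otimes> inv a \<in> U})"
  proof (intro subset_antisym subsetI)
    fix x assume "x \<in> U <#> A"
    then obtain a u where au: "a \<in> A" "u \<in> U" "x = u \<otimes> a" by (auto simp: set_mult_def)
    then have "a \<in> carrier G" "u \<in> carrier G" using A openin_carrier[OF U] by auto
    then show "x \<in> (\<Union>a\<in>A. {x \<in> carrier G. x \<otimes> inv a \<in> U})"
      using au by (auto simp: m_assoc intro!: bexI[of _ a])
  next
    fix x assume "x \<in> (\<Union>a\<in>A. {x \<in> carrier G. x \<otimes> inv a \<in> U})"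
    then obtain a where a: "a \<in> A" "x \<in> carrier G" "x \<otimes> inv a \<in> U" by auto
    then have "x = (x \<otimes> inv a) \<otimes> a" using A by (auto simp: m_assoc)
    then show "x \<in> U <#> A" using a unfolding set_mult_def by blast
  qed
  moreover have "openin T (\<Union>a\<in>A. {x \<in> carrier G. x \<otimes> inv a \<in> U})"
    using A by (intro openin_Union ballI) (auto intro!: openin_right_translate[OF U])
  ultimately show ?thesis by simp
qed

text \<open>
  Saturating a symmetric open neighbourhood of \<open>K\<close> on both sides makes it bi-invariant. It stays
  small or relatively compact if the given one is, as the next two constructions exploit.
\<close>

lemma biinvariant_hull:
  assumes K: "subgroup K G" and V: "openin T V" "K \<subseteq> V" and sym: "\<And>v. v \<in> V \<Longrightarrow> inv v \<in> V"
  shows "biinvariant_nbhd K (K <#> V <#> K)"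
proof -
  have Kc: "K \<subseteq> carrier G" using subgroup.subset[OF K] .
  have mem: "x \<in> K <#> V <#> K \<longleftrightarrow> (\<exists>h\<in>K. \<exists>v\<in>V. \<exists>k\<in>K. x = h \<otimes> v \<otimes> k)" for x
    by (auto simp: set_mult_def)
  have c: "h \<in> K \<Longrightarrow> h \<in> carrier G" "v \<in> V \<Longrightarrow> v \<in> carrier G" for h v
    using Kc openin_carrier[OF V(1)] by auto
  show ?thesis
    unfolding biinvariant_nbhd_def
  proof (intro conjI ballI)
    show "openin T (K <#> V <#> K)"
      by (intro openin_set_mult_right openin_set_mult_left Kc V)
    show "K \<subseteq> K <#> V <#> K"
    proof
      fix k assume "k \<in> K"
      moreover have "k = \<one> \<otimes> k \<otimes> \<one>" using c \<open>k \<in> K\<close> by simp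
      ultimately show "k \<in> K <#> V <#> K"
        unfolding mem using subgroup.one_closed[OF K] V(2) by blast
    qed
  next
    fix w assume "w \<in> K <#> V <#> K"
    then obtain h v k where w: "h \<in> K" "v \<in> V" "k \<in> K" "w = h \<otimes> v \<otimes> k" unfolding mem by blast
    then have "inv w = inv k \<otimes> inv v \<otimes> inv h"
      using c by (simp add: inv_mult_group m_assoc)
    then show "inv w \<in> K <#> V <#> K"
      unfolding mem using sym[OF w(2)] w subgroup.m_inv_closed[OF K] by blast
  next
    fix w a b assume "w \<in> K <#> V <#> K" and ab: "a \<in> K" "b \<in> K"
    then obtain h v k where w: "h \<in> K" "v \<in> V" "k \<in> K" "w = h \<otimes> v \<otimes> k" unfolding mem by blast
    then have "a \<otimes> w \<otimes> b = (a \<otimes> h) \<otimes> v \<otimes> (k \<otimes> b)"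
      using c ab by (simp add: m_assoc)
    then show "a \<otimes> w \<otimes> b \<in> K <#> V <#> K"
      unfolding mem using w ab subgroup.m_closed[OF K] by blast
  qed
qed

text \<open>
  Multiplication maps the compact set \<open>K \<times> K\<close> into \<open>Q\<close>, so by Wallace's theorem it maps a whole
  box around \<open>K \<times> K\<close> there.
\<close>

lemma symmetric_square_nbhd:
  assumes K: "subgroup K G" "compactin T K" and Q: "openin T Q" "K \<subseteq> Q"
  obtains V where "openin T V" "K \<subseteq> V" "\<And>v. v \<in> V \<Longrightarrow> inv v \<in> V"
    "\<And>v w. v \<in> V \<Longrightarrow> w \<in> V \<Longrightarrow> v \<otimes> w \<in> Q"
proof -
  let ?P = "{z \<in> topspace (prod_topology T T). (case z of (x, y) \<Rightarrow> x \<otimes> y) \<in> Q}"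
  have "openin (prod_topology T T) ?P"
    by (rule openin_continuous_map_preimage[OF continuous_mult Q(1)])
  moreover have "K \<times> K \<subseteq> ?P"
    using subgroup.m_closed[OF K(1)] Q(2) subgroup.subset[OF K(1)] by (auto simp: topspace_eq)
  ultimately obtain U1 U2 where U: "openin T U1" "openin T U2" "K \<subseteq> U1" "K \<subseteq> U2" "U1 \<times> U2 \<subseteq> ?P"
    by (rule Wallace_theorem_prod_topology[OF K(2) K(2)])
  define V where "V = (U1 \<inter> U2) \<inter> {x \<in> carrier G. inv x \<in> U1 \<inter> U2}"
  show thesis
  proof
    show "openin T V" unfolding V_def by (intro openin_Int openin_inverse U)
    show "K \<subseteq> V"
      unfolding V_def using U subgroup.subset[OF K(1)] subgroup.m_inv_closed[OF K(1)] by blast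
    show "inv v \<in> V" if "v \<in> V" for v
      using that unfolding V_def by auto
    show "v \<otimes> w \<in> Q" if "v \<in> V" "w \<in> V" for v w
      using that U(5) unfolding V_def by auto
  qed
qed

text \<open>
  Four successive halvings of \<open>Q\<close>: the first two leave room for a product of three factors, the
  last two for the factors from \<open>K\<close> on either side that the bi-invariant hull introduces.
\<close>

lemma biinvariant_nbhd_cube_subset:
  assumes K: "subgroup K G" "compactin T K" and Q: "openin T Q" "K \<subseteq> Q"
  obtains W where "biinvariant_nbhd K W" "\<And>a b c. a \<in> W \<Longrightarrow> b \<in> W \<Longrightarrow> c \<in> W \<Longrightarrow> a \<otimes> b \<otimes> c \<in> Q"
proof -
  obtain V1 where V1: "openin T V1" "K \<subseteq> V1" "\<And>v. v \<in> V1 \<Longrightarrow> inv v \<in> V1"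
    "\<And>v w. v \<in> V1 \<Longrightarrow> w \<in> V1 \<Longrightarrow> v \<otimes> w \<in> Q"
    using symmetric_square_nbhd[OF K Q] by metis
  obtain V2 where V2: "openin T V2" "K \<subseteq> V2" "\<And>v. v \<in> V2 \<Longrightarrow> inv v \<in> V2"
    "\<And>v w. v \<in> V2 \<Longrightarrow> w \<in> V2 \<Longrightarrow> v \<otimes> w \<in> V1"
    using symmetric_square_nbhd[OF K V1(1,2)] by metis
  obtain V3 where V3: "openin T V3" "K \<subseteq> V3" "\<And>v. v \<in> V3 \<Longrightarrow> inv v \<in> V3"
    "\<And>v w. v \<in> V3 \<Longrightarrow> w \<in> V3 \<Longrightarrow> v \<otimes> w \<in> V2"
    using symmetric_square_nbhd[OF K V2(1,2)] by metis
  obtain V4 where V4: "openin T V4" "K \<subseteq> V4" "\<And>v. v \<in> V4 \<Longrightarrow> inv v \<in> V4"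
    "\<And>v w. v \<in> V4 \<Longrightarrow> w \<in> V4 \<Longrightarrow> v \<otimes> w \<in> V3"
    using symmetric_square_nbhd[OF K V3(1,2)] by metis
  have V43: "V4 \<subseteq> V3"
  proof
    fix v assume "v \<in> V4"
    moreover have "\<one> \<in> V4" using V4(2) subgroup.one_closed[OF K(1)] by blast
    ultimately have "v \<otimes> \<one> \<in> V3" by (rule V4(4))
    then show "v \<in> V3" using openin_carrier[OF V4(1) \<open>v \<in> V4\<close>] by simp
  qed
  have W2: "x \<in> V2" if x_in: "x \<in> K <#> V4 <#> K" for x
  proof -
    obtain h v k where x: "h \<in> K" "v \<in> V4" "k \<in> K" "x = h \<otimes> v \<otimes> k"
      using x_in by (auto simp: set_mult_def)
    have "h \<otimes> v \<in> V3" using V4(2) x by (intro V4(4)) auto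
    moreover have "k \<in> V3" using V4(2) V43 x by auto
    ultimately show ?thesis unfolding x(4) by (rule V3(4))
  qed
  have V21: "V2 \<subseteq> V1"
  proof
    fix v assume "v \<in> V2"
    moreover have "\<one> \<in> V2" using V2(2) subgroup.one_closed[OF K(1)] by blast
    ultimately have "v \<otimes> \<one> \<in> V1" by (rule V2(4))
    then show "v \<in> V1" using openin_carrier[OF V2(1) \<open>v \<in> V2\<close>] by simp
  qed
  show thesis
  proof
    show "biinvariant_nbhd K (K <#> V4 <#> K)"
      using biinvariant_hull[OF K(1) V4(1,2,3)] .
    show "a \<otimes> b \<otimes> c \<in> Q"
      if "a \<in> K <#> V4 <#> K" "b \<in> K <#> V4 <#> K" "c \<in> K <#> V4 <#> K" for a b c
      using W2[OF that(1)] W2[OF that(2)] W2[OF that(3)] V2(4) V21 V1(4) by blast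
  qed
qed

text \<open>
  Thicken \<open>L \<union> K\<close> by a relatively compact neighbourhood of \<open>\<one>\<close>, symmetrize, and saturate.
  All three operations keep the set inside a product of compact sets.
\<close>

lemma biinvariant_nbhd_of_compact:
  assumes lc: "locally_compact_space T" and K: "subgroup K G" "compactin T K" and L: "compactin T L"
  obtains W where "biinvariant_nbhd K W" "relatively_compact W" "L \<subseteq> W"
proof -
  obtain U D where UD: "openin T U" "compactin T D" "\<one> \<in> U" "U \<subseteq> D"
    using lc one_closed unfolding locally_compact_space_def topspace_eq by blast
  define L' where "L' = L \<union> K"
  have L': "compactin T L'" "L' \<subseteq> carrier G"
    unfolding L'_def using L K compactin_Un compactin_carrier by blast+
  define V where "V = (L' <#> U) \<union> {x \<in> carrier G. inv x \<in> L' <#> U}"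
  have LU: "openin T (L' <#> U)" by (rule openin_set_mult_left[OF L'(2) UD(1)])
  have sub: "L' \<subseteq> L' <#> U"
  proof
    fix x assume "x \<in> L'"
    then have "x = x \<otimes> \<one>" using L' by auto
    then show "x \<in> L' <#> U" unfolding set_mult_def using \<open>x \<in> L'\<close> UD(3) by blast
  qed
  have V: "openin T V" "L' \<subseteq> V"
    unfolding V_def using LU openin_inverse sub by auto
  have "inv v \<in> V" if "v \<in> V" for v
    using that openin_carrier[OF LU] unfolding V_def by auto
  then have bi: "biinvariant_nbhd K (K <#> V <#> K)"
    using biinvariant_hull K V unfolding L'_def by blast
  define C where "C = (L' <#> D) \<union> (\<lambda>x. inv x) ` (L' <#> D)"
  have C: "compactin T C"
    unfolding C_def by (intro compactin_Un compactin_set_inv compactin_set_mult L' UD)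
  have "L' <#> U \<subseteq> L' <#> D" using UD(4) by (auto simp: set_mult_def)
  then have "V \<subseteq> C"
    unfolding V_def C_def by (auto simp: image_iff) (metis inv_inv subsetD)
  then have "K <#> V <#> K \<subseteq> K <#> C <#> K" unfolding set_mult_def by blast
  moreover have "compactin T (K <#> C <#> K)" by (intro compactin_set_mult K C)
  ultimately have "relatively_compact (K <#> V <#> K)" unfolding relatively_compact_def by blast
  moreover have "V \<subseteq> K <#> V <#> K"
  proof
    fix v assume v: "v \<in> V"
    then have "v = \<one> \<otimes> v \<otimes> \<one>" using openin_carrier[OF V(1)] by simp
    then show "v \<in> K <#> V <#> K"
      unfolding set_mult_def using v subgroup.one_closed[OF K(1)] by blast
  qed
  ultimately show thesis using that bi V unfolding L'_def by blast
qed

text \<open>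
  Starting from one relatively compact bi-invariant neighbourhood, shrink repeatedly to fill the
  negative indices, at step \<open>i\<close> getting below \<open>Q i\<close>, and enlarge repeatedly to fill the positive
  ones, at step \<open>i\<close> swallowing \<open>C i\<close>. If the \<open>Q i\<close> form a base of saturated neighbourhoods and the
  \<open>C i\<close> cover the group, the scale controls both the topology and infinity.
\<close>

lemma biinvariant_scale_exists:
  fixes Q C :: "nat \<Rightarrow> 'a set"
  assumes lc: "locally_compact_space T" and K: "subgroup K G" "compactin T K"
    and Q: "\<And>i. openin T (Q i)" "\<And>i. K \<subseteq> Q i"
    and C: "\<And>i. compactin T (C i)"
  shows "\<exists>W :: int \<Rightarrow> 'a set.
    (\<forall>n. biinvariant_nbhd K (W n) \<and> relatively_compact (W n) \<and>
       (\<forall>a\<in>W n. \<forall>b\<in>W n. \<forall>c\<in>W n. a \<otimes> b \<otimes> c \<in> W (n + 1))) \<and>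
    (\<forall>i. (\<exists>n. W n \<subseteq> Q i) \<and> (\<exists>n. C i \<subseteq> W n))"
proof -
  define good where "good W \<longleftrightarrow> biinvariant_nbhd K W \<and> relatively_compact W" for W
  define cube where "cube W W' \<longleftrightarrow> (\<forall>a\<in>W. \<forall>b\<in>W. \<forall>c\<in>W. a \<otimes> b \<otimes> c \<in> W')" for W W'
  have shrink: "\<exists>W'. good W' \<and> cube W' W \<and> W' \<subseteq> Q i" if W: "good W" for W i
  proof -
    have "openin T (W \<inter> Q i)" "K \<subseteq> W \<inter> Q i"
      using W Q openin_Int unfolding good_def biinvariant_nbhd_def by auto
    then obtain W' where W': "biinvariant_nbhd K W'" "cube W' (W \<inter> Q i)"
      using biinvariant_nbhd_cube_subset[OF K] unfolding cube_def by metis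
    moreover have "W' \<subseteq> W \<inter> Q i"
    proof
      fix w assume w: "w \<in> W'"
      have "openin T W'" "\<one> \<in> W'"
        using W' subgroup.one_closed[OF K(1)] unfolding biinvariant_nbhd_def by auto
      then have "w \<otimes> \<one> \<otimes> \<one> \<in> W \<inter> Q i" "w \<in> carrier G"
        using w W'(2) openin_carrier unfolding cube_def by blast+
      then show "w \<in> W \<inter> Q i" by simp
    qed
    ultimately show ?thesis
      using W unfolding good_def relatively_compact_def cube_def by blast
  qed
  have grow: "\<exists>W'. good W' \<and> cube W W' \<and> C i \<subseteq> W'" if W: "good W" for W i
  proof -
    obtain D where D: "compactin T D" "W \<subseteq> D"
      using W unfolding good_def relatively_compact_def by blast
    have "compactin T ((D <#> D <#> D) \<union> C i)"
      by (intro compactin_Un compactin_set_mult D C)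
    then obtain W' where W': "biinvariant_nbhd K W'" "relatively_compact W'" "(D <#> D <#> D) \<union> C i \<subseteq> W'"
      using biinvariant_nbhd_of_compact[OF lc K] by metis
    have "cube W W'" unfolding cube_def
    proof (intro ballI)
      fix a b c assume "a \<in> W" "b \<in> W" "c \<in> W"
      then have "a \<otimes> b \<otimes> c \<in> D <#> D <#> D" using D(2) unfolding set_mult_def by blast
      then show "a \<otimes> b \<otimes> c \<in> W'" using W' by blast
    qed
    then show ?thesis using W' unfolding good_def by blast
  qed
  have "\<exists>W. good W" using biinvariant_nbhd_of_compact[OF lc K K(2)] unfolding good_def by metis
  then have "\<exists>N. \<forall>i. good (N i) \<and> cube (N (Suc i)) (N i) \<and> N (Suc i) \<subseteq> Q i"
    using dependent_nat_choice[of "\<lambda>_. good" "\<lambda>i W W'. cube W' W \<and> W' \<subseteq> Q i"] shrink by auto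
  then obtain N where N: "\<And>i. good (N i)" "\<And>i. cube (N (Suc i)) (N i)" "\<And>i. N (Suc i) \<subseteq> Q i"
    by blast
  \<comment> \<open>The condition at \<open>i = 0\<close> glues the two halves of the scale together.\<close>
  have "\<exists>P. \<forall>i. (good (P i) \<and> (i = 0 \<longrightarrow> P i = N 0)) \<and> (cube (P i) (P (Suc i)) \<and> C i \<subseteq> P (Suc i))"
    by (rule dependent_nat_choice) (use N grow in auto)
  then obtain P where P: "\<And>i. good (P i)" "P 0 = N 0" "\<And>i. cube (P i) (P (Suc i))" "\<And>i. C i \<subseteq> P (Suc i)"
    by blast
  define W where "W n = (if n \<ge> 0 then P (nat n) else N (nat (- n)))" for n :: int
  have W_neg: "W n = N (nat (- n))" if "n \<le> 0" for n using that P(2) by (auto simp: W_def)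
  have good: "good (W n)" for n using N P by (auto simp: W_def)
  have cube: "cube (W n) (W (n + 1))" for n
  proof (cases "n \<ge> 0")
    case True
    then have "nat (n + 1) = Suc (nat n)" by simp
    then show ?thesis using True P(3) by (simp add: W_def)
  next
    case False
    then have "nat (- n) = Suc (nat (- (n + 1)))" by simp
    then show ?thesis using False N(2)[of "nat (- (n + 1))"] by (simp add: W_neg)
  qed
  have "W (- int (Suc i)) \<subseteq> Q i" for i using N(3)[of i] by (simp add: W_neg nat_add_distrib)
  moreover have "C i \<subseteq> W (int (Suc i))" for i
    using P(4)[of i] unfolding W_def by (simp add: nat_add_distrib)
  ultimately have "\<forall>i. (\<exists>n. W n \<subseteq> Q i) \<and> (\<exists>n. C i \<subseteq> W n)" by blast
  then show ?thesis
    using good cube unfolding good_def cube_def by (intro exI[of _ W]) simp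
qed

end

section \<open>From a model with compact stabilizer to a proper invariant metric\<close>

lemma countable_compact_cover:
  assumes "second_countable T" "locally_compact_space T"
  obtains C :: "nat \<Rightarrow> 'a set" where "\<And>i. compactin T (C i)" "topspace T \<subseteq> (\<Union>i. C i)"
proof -
  define \<U> where "\<U> = {U. openin T U \<and> (\<exists>K. compactin T K \<and> U \<subseteq> K)}"
  have "\<Union>\<U> = topspace T"
  proof
    show "\<Union>\<U> \<subseteq> topspace T" unfolding \<U>_def using openin_subset by auto
    show "topspace T \<subseteq> \<Union>\<U>"
    proof
      fix x assume "x \<in> topspace T"
      then obtain U K where "openin T U \<and> compactin T K \<and> x \<in> U \<and> U \<subseteq> K"
        using assms(2) unfolding locally_compact_space_def by meson
      then show "x \<in> \<Union>\<U>" unfolding \<U>_def by auto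
    qed
  qed
  moreover have "\<forall>U\<in>\<U>. openin T U" by (simp add: \<U>_def)
  ultimately obtain \<V> where \<V>: "countable \<V>" "\<V> \<subseteq> \<U>" "topspace T = \<Union>\<V>"
    using second_countable_imp_Lindelof_space[OF assms(1)] unfolding Lindelof_space_def by metis
  have "\<forall>U\<in>\<U>. \<exists>K. compactin T K \<and> U \<subseteq> K" by (auto simp: \<U>_def)
  then obtain k where k: "\<And>U. U \<in> \<U> \<Longrightarrow> compactin T (k U) \<and> U \<subseteq> k U" by metis
  define C where "C = from_nat_into (insert {} (k ` \<V>))"
  have range: "range C = insert {} (k ` \<V>)"
    unfolding C_def using \<V>(1) by (intro range_from_nat_into) auto
  show thesis
  proof
    show "compactin T (C i)" for i
    proof -
      have "C i \<in> insert {} (k ` \<V>)" using range by blast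
      then show ?thesis using k \<V>(2) by auto
    qed
    show "topspace T \<subseteq> (\<Union>i. C i)"
      unfolding range \<V>(3) using k \<V>(2) by auto
  qed
qed

text \<open>
  Compactness of \<open>H'\<close> provides a scale of bi-invariant neighbourhoods of \<open>H'\<close> in \<open>G'\<close>, and the
  preimages under \<open>\<phi>\<close> form a scale for \<open>H\<close> in \<open>G\<close>. The inverse \<open>\<theta>\<close> of the homeomorphism
  carries compact subsets of \<open>G'/H'\<close> back to \<open>G/H\<close>, and its continuity gives the countable base
  \<open>Q\<close>: the sets \<open>Q i\<close> are the preimages in \<open>G'\<close> of a countable base at the point \<open>H\<close> of the second
  countable space \<open>G/H\<close>. The images of a countable compact cover of \<open>G\<close> make the scale exhaust
  the image of \<open>\<phi>\<close>.
\<close>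

lemma has_proper_invariant_metric_of_model:
  fixes G :: "('a, 'm) monoid_scheme" and G' :: "('b, 'n) monoid_scheme"
  assumes "topological_group G T" and sc: "second_countable T" and lc: "locally_compact_space T"
    and H: "subgroup H G" and closed: "closedin T H"
    and model: "proper_homogeneous_model G T H G' T' H' \<phi>"
  shows "has_proper_invariant_metric G T H"
proof -
  interpret G: topological_group G T by fact
  have *: "topological_group G' T'" "locally_compact_space T'" "\<phi> \<in> hom G G'"
    "continuous_map T T' \<phi>" "subgroup H' G'" "compactin T' H'" "\<phi> ` H \<subseteq> H'"
    and homeo: "homeomorphic_map (coset_topology G T H) (coset_topology G' T' H')
      (induced_coset_map G H G' H' \<phi>)"
    using model unfolding proper_homogeneous_model_def by auto
  interpret G': topological_group G' T' by fact
  define \<psi> where "\<psi> = induced_coset_map G H G' H' \<phi>"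
  have \<psi>: "\<psi> (g <#\<^bsub>G\<^esub> H) = \<phi> g <#\<^bsub>G'\<^esub> H'" if "g \<in> carrier G" for g
    unfolding \<psi>_def
    by (rule induced_coset_map_eq[OF G.is_group G'.is_group H *(5) *(3) *(7) that])
  obtain \<theta> where \<theta>: "homeomorphic_maps (coset_topology G T H) (coset_topology G' T' H') \<psi> \<theta>"
    using homeo unfolding \<psi>_def homeomorphic_map_maps by blast
  have \<theta>_cont: "continuous_map (coset_topology G' T' H') (coset_topology G T H) \<theta>"
    and \<theta>\<psi>: "\<And>X. X \<in> lcosets\<^bsub>G\<^esub> H \<Longrightarrow> \<theta> (\<psi> X) = X"
    and \<psi>\<theta>: "\<And>X. X \<in> lcosets\<^bsub>G'\<^esub> H' \<Longrightarrow> \<psi> (\<theta> X) = X"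
    using \<theta> unfolding homeomorphic_maps_def
    by (auto simp: G.topspace_coset_topology G'.topspace_coset_topology)
  have \<phi>c: "\<phi> g \<in> carrier G'" if "g \<in> carrier G" for g
    using *(3) that by (simp add: hom_in_carrier)
  interpret \<phi>: group_hom G G' \<phi>
    by unfold_locales (rule *(3))
  have pre: "openin T {g \<in> carrier G. \<phi> g \<in> V}" if "openin T' V" for V
    using openin_continuous_map_preimage[OF *(4) that] by (simp add: G.topspace_eq)

  have "second_countable (coset_topology G T H)"
    by (rule G.second_countable_coset_topology[OF H sc])
  then obtain \<B> where \<B>: "countable \<B>" "\<forall>V\<in>\<B>. openin (coset_topology G T H) V"
    "\<forall>U x. openin (coset_topology G T H) U \<and> x \<in> U \<longrightarrow> (\<exists>V\<in>\<B>. x \<in> V \<and> V \<subseteq> U)"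
    unfolding second_countable_def by (elim exE conjE)
  have H_coset: "H \<in> lcosets\<^bsub>G\<^esub> H"
    using G.l_coset_in_lcosets[OF G.one_closed, of H] G.l_coset_subgroup[OF H] by simp
  define \<B>H where "\<B>H = {V \<in> \<B>. H \<in> V}"
  have "\<B>H \<noteq> {}"
    using \<B>(3)[rule_format, OF conjI, OF openin_topspace, of H] H_coset
    unfolding \<B>H_def G.topspace_coset_topology by auto
  moreover have "countable \<B>H" using \<B>(1) unfolding \<B>H_def by auto
  ultimately have range: "range (from_nat_into \<B>H) = \<B>H"
    by (rule range_from_nat_into)
  define B where "B = from_nat_into \<B>H"
  have B: "openin (coset_topology G T H) (B i)" "H \<in> B i" for i
  proof -
    have "B i \<in> \<B>H" using range unfolding B_def by blast
    then show "openin (coset_topology G T H) (B i)" "H \<in> B i"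
      using \<B>(2) unfolding \<B>H_def by auto
  qed
  have B_base: "\<exists>i. B i \<subseteq> U" if U: "openin (coset_topology G T H) U" "H \<in> U" for U
  proof -
    obtain V where "V \<in> \<B>" "H \<in> V" "V \<subseteq> U"
      using \<B>(3)[rule_format, OF conjI, OF U] by blast
    then have "V \<in> \<B>H" by (simp add: \<B>H_def)
    with \<open>V \<subseteq> U\<close> show ?thesis using range unfolding B_def by (metis rangeE)
  qed
  define Q where "Q i = {x \<in> carrier G'. \<theta> (x <#\<^bsub>G'\<^esub> H') \<in> B i}" for i
  have Q_open: "openin T' (Q i)" for i
    using openin_continuous_map_preimage[OF continuous_map_compose[OF
          G'.continuous_map_coset_projection[of H'] \<theta>_cont] B(1)[of i]]
    by (simp add: Q_def G'.topspace_eq)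
  have "\<psi> H = H'"
    using \<psi>[OF G.one_closed] G.l_coset_subgroup[OF H] G'.l_coset_subgroup[OF *(5)] by simp
  then have "\<theta> H' = H" using \<theta>\<psi>[OF H_coset] by simp
  moreover have "x <#\<^bsub>G'\<^esub> H' = H'" if "x \<in> H'" for x
    using G'.l_coset_eq_iff[OF *(5) G'.one_closed, of x] G'.l_coset_subgroup[OF *(5)] that
      subgroup.mem_carrier[OF *(5) that] by simp
  ultimately have Q_sub: "H' \<subseteq> Q i" for i
    using B(2)[of i] subgroup.mem_carrier[OF *(5)] by (auto simp: Q_def)
  obtain C where C: "\<And>i. compactin T (C i)" "topspace T \<subseteq> (\<Union>i::nat. C i)"
    using countable_compact_cover[OF sc lc] by metis
  obtain W :: "int \<Rightarrow> 'b set" where W12: "\<forall>n. G'.biinvariant_nbhd H' (W n) \<and> G'.relatively_compact (W n) \<and>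
      (\<forall>a\<in>W n. \<forall>b\<in>W n. \<forall>c\<in>W n. a \<otimes>\<^bsub>G'\<^esub> b \<otimes>\<^bsub>G'\<^esub> c \<in> W (n + 1))"
    and W45: "\<forall>i. (\<exists>n. W n \<subseteq> Q i) \<and> (\<exists>n. \<phi> ` C i \<subseteq> W n)"
    using G'.biinvariant_scale_exists[of H' Q "\<lambda>i. \<phi> ` C i", OF *(2,5,6) Q_open Q_sub
        image_compactin[OF C(1) *(4)]] by (elim exE conjE)
  have W: "G'.biinvariant_nbhd H' (W n)" "G'.relatively_compact (W n)"
    "a \<in> W n \<Longrightarrow> b \<in> W n \<Longrightarrow> c \<in> W n \<Longrightarrow> a \<otimes>\<^bsub>G'\<^esub> b \<otimes>\<^bsub>G'\<^esub> c \<in> W (n + 1)"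
    "\<exists>n. W n \<subseteq> Q i" "\<exists>n. \<phi> ` C i \<subseteq> W n" for n a b c i
    using W12 W45 by auto
  note W1 = W(1)[unfolded G'.biinvariant_nbhd_def]
  define A where "A n = {g \<in> carrier G. \<phi> g \<in> W n}" for n
  show ?thesis
  proof (rule G.has_proper_invariant_metric_of_scale[OF H closed])
    show "openin T (A n)" for n unfolding A_def using pre W1 by blast
    show "inv\<^bsub>G\<^esub> a \<in> A n" if "a \<in> A n" for n a
      using that W1[of n] by (auto simp: A_def)
    show "H \<subseteq> A n" for n
      using W1[of n] *(7) subgroup.mem_carrier[OF H] by (auto simp: A_def)
    show "h \<otimes>\<^bsub>G\<^esub> a \<otimes>\<^bsub>G\<^esub> k \<in> A n" if "a \<in> A n" "h \<in> H" "k \<in> H" for n a h k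
    proof -
      have "h \<in> carrier G" "k \<in> carrier G" "\<phi> h \<in> H'" "\<phi> k \<in> H'"
        using that *(7) subgroup.mem_carrier[OF H] by auto
      then show ?thesis using that W1[of n] by (auto simp: A_def)
    qed
    show "a \<otimes>\<^bsub>G\<^esub> b \<otimes>\<^bsub>G\<^esub> c \<in> A (n + 1)" if "a \<in> A n" "b \<in> A n" "c \<in> A n" for n a b c
      using that W(3)[of "\<phi> a" n "\<phi> b" "\<phi> c"] by (auto simp: A_def)
    show "\<exists>n. g \<in> A n" if g: "g \<in> carrier G" for g
    proof -
      obtain i where "g \<in> C i" using C(2) g by (auto simp: G.topspace_eq)
      then show ?thesis using W(5)[of i] g by (auto simp: A_def)
    qed
    show "\<exists>n. \<forall>a\<in>A n. a <#\<^bsub>G\<^esub> H \<in> U" if U: "openin (coset_topology G T H) U" "H \<in> U" for U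
    proof -
      obtain i where i: "B i \<subseteq> U" using B_base[OF U] by blast
      obtain n where n: "W n \<subseteq> Q i" using W(4) by blast
      have "a <#\<^bsub>G\<^esub> H \<in> U" if "a \<in> A n" for a
      proof -
        have a: "a \<in> carrier G" "\<phi> a \<in> Q i" using that n by (auto simp: A_def)
        have "\<theta> (\<phi> a <#\<^bsub>G'\<^esub> H') = a <#\<^bsub>G\<^esub> H"
          using \<theta>\<psi>[OF G.l_coset_in_lcosets[OF a(1), of H]] \<psi>[OF a(1)] by simp
        then show ?thesis using a(2) i by (auto simp: Q_def)
      qed
      then show ?thesis by blast
    qed
    show "\<exists>D. compactin (coset_topology G T H) D \<and> (\<forall>a\<in>A n. a <#\<^bsub>G\<^esub> H \<in> D)" for n
    proof -
      obtain D where D: "compactin T' D" "W n \<subseteq> D"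
        using W(2)[of n] unfolding G'.relatively_compact_def by blast
      have "compactin (coset_topology G T H) (\<theta> ` (\<lambda>x. x <#\<^bsub>G'\<^esub> H') ` D)"
        by (intro image_compactin[OF _ \<theta>_cont]
            image_compactin[OF D(1) G'.continuous_map_coset_projection])
      moreover have "a <#\<^bsub>G\<^esub> H \<in> \<theta> ` (\<lambda>x. x <#\<^bsub>G'\<^esub> H') ` D" if "a \<in> A n" for a
      proof -
        have a: "a \<in> carrier G" "\<phi> a \<in> D" using that D(2) by (auto simp: A_def)
        have "\<theta> (\<phi> a <#\<^bsub>G'\<^esub> H') = a <#\<^bsub>G\<^esub> H"
          using \<theta>\<psi>[OF G.l_coset_in_lcosets[OF a(1), of H]] \<psi>[OF a(1)] by simp
        then show ?thesis using a(2) by force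
      qed
      ultimately show ?thesis by blast
    qed
  qed
qed

section \<open>The isometry group of a proper metric space\<close>

context Metric_space
begin

text \<open>
  Isometries are functions on \<open>M\<close>, represented as extensional functions like the elements of
  \<open>BijGroup M\<close>. This makes them points of the product space \<open>M \<rightarrow> M\<close>, so that the topology of
  pointwise convergence is a subspace topology.
\<close>

definition isometries :: "('a \<Rightarrow> 'a) set" where
  "isometries = {f \<in> Bij M. \<forall>x\<in>M. \<forall>y\<in>M. d (f x) (f y) = d x y}"

definition isometry_group :: "('a \<Rightarrow> 'a) monoid" where
  "isometry_group = (BijGroup M)\<lparr>carrier := isometries\<rparr>"

definition isometry_topology :: "('a \<Rightarrow> 'a) topology" where
  "isometry_topology = subtopology (product_topology (\<lambda>_. mtopology) M) isometries"

lemma isometry_in: "f \<in> isometries \<Longrightarrow> x \<in> M \<Longrightarrow> f x \<in> M"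
  by (auto simp: isometries_def Bij_def bij_betw_def)

lemma isometry_dist: "f \<in> isometries \<Longrightarrow> x \<in> M \<Longrightarrow> y \<in> M \<Longrightarrow> d (f x) (f y) = d x y"
  by (auto simp: isometries_def)

lemma isometry_extensional: "f \<in> isometries \<Longrightarrow> f \<in> extensional M"
  by (auto simp: isometries_def Bij_def)

lemma isometry_eqI:
  "f \<in> isometries \<Longrightarrow> g \<in> isometries \<Longrightarrow> (\<And>x. x \<in> M \<Longrightarrow> f x = g x) \<Longrightarrow> f = g"
  using extensionalityI isometry_extensional by blast

lemma isometryI:
  assumes "f \<in> extensional M" "\<And>x. x \<in> M \<Longrightarrow> f x \<in> M"
    "\<And>x y. x \<in> M \<Longrightarrow> y \<in> M \<Longrightarrow> d (f x) (f y) = d x y"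
    "\<And>y. y \<in> M \<Longrightarrow> \<exists>x\<in>M. f x = y"
  shows "f \<in> isometries"
proof -
  have "inj_on f M"
    using assms(2,3) by (intro inj_onI) (metis zero)
  moreover have "f ` M = M" using assms(2,4) by auto
  ultimately show ?thesis
    using assms by (simp add: isometries_def Bij_def bij_betw_def)
qed

lemma isometry_compose:
  assumes f: "f \<in> isometries" and g: "g \<in> isometries"
  shows "compose M f g \<in> isometries"
  using assms compose_Bij[of f M g]
  by (auto simp: isometries_def compose_eq isometry_in Bij_imp_funcset[THEN funcset_mem])

lemma isometry_inverse:
  assumes f: "f \<in> isometries"
  shows "restrict (inv_into M f) M \<in> isometries"
    and "x \<in> M \<Longrightarrow> inv_into M f x \<in> M" and "x \<in> M \<Longrightarrow> f (inv_into M f x) = x"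
    and "x \<in> M \<Longrightarrow> inv_into M f (f x) = x"
proof -
  have bij: "f ` M = M" "inj_on f M"
    using f by (auto simp: isometries_def Bij_def bij_betw_def)
  show in_M: "x \<in> M \<Longrightarrow> inv_into M f x \<in> M" and right: "x \<in> M \<Longrightarrow> f (inv_into M f x) = x"
    and left: "x \<in> M \<Longrightarrow> inv_into M f (f x) = x" for x
    using bij by (metis inv_into_into, metis f_inv_into_f, metis inv_into_f_f)
  show "restrict (inv_into M f) M \<in> isometries"
  proof (rule isometryI)
    show "d (restrict (inv_into M f) M x) (restrict (inv_into M f) M y) = d x y"
      if "x \<in> M" "y \<in> M" for x y
      using that isometry_dist[OF f in_M[OF that(1)] in_M[OF that(2)]] right by simp
    show "\<exists>x\<in>M. restrict (inv_into M f) M x = y" if "y \<in> M" for y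
      using that left isometry_in[OF f] by (intro bexI[of _ "f y"]) auto
  qed (use in_M in auto)
qed

lemma carrier_isometry_group [simp]: "carrier isometry_group = isometries"
  by (simp add: isometry_group_def)

lemma mult_isometry_group:
  "f \<in> isometries \<Longrightarrow> g \<in> isometries \<Longrightarrow> f \<otimes>\<^bsub>isometry_group\<^esub> g = compose M f g"
  by (simp add: isometry_group_def BijGroup_def isometries_def)

lemma subgroup_isometries: "subgroup isometries (BijGroup M)"
proof
  show "isometries \<subseteq> carrier (BijGroup M)" by (auto simp: isometries_def BijGroup_def)
  show "f \<otimes>\<^bsub>BijGroup M\<^esub> g \<in> isometries" if "f \<in> isometries" "g \<in> isometries" for f g
    using mult_isometry_group[OF that] isometry_compose[OF that] by (simp add: isometry_group_def)
  show "\<one>\<^bsub>BijGroup M\<^esub> \<in> isometries" by (auto simp: BijGroup_def intro!: isometryI)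
  show "inv\<^bsub>BijGroup M\<^esub> f \<in> isometries" if "f \<in> isometries" for f
    using isometry_inverse(1)[OF that] that inv_BijGroup[of f M] by (simp add: isometries_def)
qed

lemma group_isometry_group: "group isometry_group"
  unfolding isometry_group_def by (rule subgroup.subgroup_is_group[OF subgroup_isometries group_BijGroup])

lemma inv_isometry_group:
  "f \<in> isometries \<Longrightarrow> inv\<^bsub>isometry_group\<^esub> f = restrict (inv_into M f) M"
  unfolding isometry_group_def
  using group.m_inv_consistent[OF group_BijGroup subgroup_isometries] inv_BijGroup[of f M]
  by (simp add: isometries_def)

lemma topspace_isometry_topology [simp]: "topspace isometry_topology = isometries"
proof -
  have "f \<in> (\<Pi>\<^sub>E i\<in>M. M)" if "f \<in> isometries" for f
    using isometry_in[OF that] isometry_extensional[OF that] unfolding PiE_iff by blast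
  then have "isometries \<subseteq> (\<Pi>\<^sub>E i\<in>M. M)" by (rule subsetI)
  then show ?thesis
    unfolding isometry_topology_def topspace_subtopology topspace_product_topology topspace_mtopology
    by (rule Int_absorb1)
qed

lemma continuous_map_into_isometry_topology:
  assumes "\<And>z. z \<in> topspace Z \<Longrightarrow> F z \<in> isometries"
    and "\<And>x. x \<in> M \<Longrightarrow> continuous_map Z mtopology (\<lambda>z. F z x)"
  shows "continuous_map Z isometry_topology F"
  unfolding isometry_topology_def continuous_map_in_subtopology continuous_map_componentwise
  using assms isometry_extensional by auto

lemma continuous_map_isometry_eval:
  "x \<in> M \<Longrightarrow> continuous_map isometry_topology mtopology (\<lambda>f. f x)"
  unfolding isometry_topology_def
  by (intro continuous_map_from_subtopology continuous_map_product_projection)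

text \<open>
  A family of isometric maps is equicontinuous, so that pointwise continuity in the parameter suffices
  for joint continuity of the evaluation. Stated for maps that merely preserve distances, it serves for
  the continuity of composition and also, in the compactness proof, for pointwise limits of isometries.
\<close>

lemma continuous_map_isometric_family:
  assumes p: "continuous_map Z mtopology p"
    and F: "\<And>x. x \<in> M \<Longrightarrow> continuous_map Z mtopology (\<lambda>z. F z x)"
    and iso: "\<And>z x y. z \<in> topspace Z \<Longrightarrow> x \<in> M \<Longrightarrow> y \<in> M \<Longrightarrow> d (F z x) (F z y) = d x y"
  shows "continuous_map Z mtopology (\<lambda>z. F z (p z))"
  unfolding continuous_map_to_metric
proof (intro ballI allI impI)
  fix z and \<epsilon> :: real assume z: "z \<in> topspace Z" and \<epsilon>: "0 < \<epsilon>"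
  have p_in: "p w \<in> M" if "w \<in> topspace Z" for w
    using continuous_map_image_subset_topspace[OF p] that by auto
  have F_in: "F w x \<in> M" if "w \<in> topspace Z" "x \<in> M" for w x
    using continuous_map_image_subset_topspace[OF F[OF that(2)]] that(1) by auto
  obtain U where U: "openin Z U" "z \<in> U" "\<forall>y\<in>U. p y \<in> mball (p z) (\<epsilon>/2)"
    using p z \<epsilon> unfolding continuous_map_to_metric by (meson half_gt_zero)
  obtain V where V: "openin Z V" "z \<in> V" "\<forall>y\<in>V. F y (p z) \<in> mball (F z (p z)) (\<epsilon>/2)"
    using F[OF p_in[OF z]] z \<epsilon> unfolding continuous_map_to_metric by (meson half_gt_zero)
  show "\<exists>U. openin Z U \<and> z \<in> U \<and> (\<forall>y\<in>U. F y (p y) \<in> mball (F z (p z)) \<epsilon>)"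
  proof (intro exI conjI ballI)
    show "openin Z (U \<inter> V)" using U V by auto
    show "z \<in> U \<inter> V" using U V by auto
    fix w assume w: "w \<in> U \<inter> V"
    then have wZ: "w \<in> topspace Z" using U(1) openin_subset by blast
    have "d (F w (p z)) (F w (p w)) = d (p z) (p w)" using iso wZ p_in z by blast
    moreover have "d (p z) (p w) < \<epsilon>/2" "d (F z (p z)) (F w (p z)) < \<epsilon>/2"
      using U V w by auto
    ultimately show "F w (p w) \<in> mball (F z (p z)) \<epsilon>"
      using triangle[of "F z (p z)" "F w (p z)" "F w (p w)"] F_in p_in z wZ by auto
  qed
qed

text \<open>
  If \<open>y\<close> is the preimage of \<open>x\<close> under \<open>f\<close>, then the preimage of \<open>x\<close> under another isometry \<open>g\<close> has
  the distance \<open>d (g y) x = d (g y) (f y)\<close> from \<open>y\<close>.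
\<close>

lemma continuous_map_isometry_inverse:
  "continuous_map isometry_topology isometry_topology (\<lambda>f. restrict (inv_into M f) M)"
proof (rule continuous_map_into_isometry_topology)
  fix x assume x: "x \<in> M"
  show "continuous_map isometry_topology mtopology (\<lambda>f. restrict (inv_into M f) M x)"
    unfolding continuous_map_to_metric
  proof (intro ballI allI impI)
    fix f and \<epsilon> :: real assume f: "f \<in> topspace isometry_topology" and \<epsilon>: "0 < \<epsilon>"
    then have f': "f \<in> isometries" by simp
    define y where "y = inv_into M f x"
    have y: "y \<in> M" "f y = x" using isometry_inverse[OF f'] x by (auto simp: y_def)
    obtain U where U: "openin isometry_topology U" "f \<in> U" "\<forall>g\<in>U. g y \<in> mball (f y) \<epsilon>"
      using continuous_map_isometry_eval[OF y(1)] f \<epsilon> unfolding continuous_map_to_metric by meson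
    show "\<exists>U. openin isometry_topology U \<and> f \<in> U \<and>
        (\<forall>g\<in>U. restrict (inv_into M g) M x \<in> mball (restrict (inv_into M f) M x) \<epsilon>)"
    proof (intro exI conjI ballI)
      fix g assume g: "g \<in> U"
      then have g': "g \<in> isometries" using U(1) openin_subset topspace_isometry_topology by blast
      have "d y (inv_into M g x) = d (g y) (g (inv_into M g x))"
        using isometry_dist[OF g' y(1) isometry_inverse(2)[OF g' x]] by simp
      also have "\<dots> = d (g y) (f y)" using isometry_inverse(3)[OF g' x] y by simp
      also have "\<dots> < \<epsilon>" using U(3) g commute by auto
      finally show "restrict (inv_into M g) M x \<in> mball (restrict (inv_into M f) M x) \<epsilon>"
        using x y isometry_inverse(2)[OF g' x] by (simp add: y_def)
    qed (use U in auto)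
  qed
qed (simp add: isometry_inverse(1))

lemma topological_group_isometry_group: "topological_group isometry_group isometry_topology"
proof -
  show ?thesis
  proof (intro topological_group.intro topological_group_axioms.intro group_isometry_group)
    show "topspace isometry_topology = carrier isometry_group" by simp
    show "Hausdorff_space isometry_topology"
      unfolding isometry_topology_def
      by (intro Hausdorff_space_subtopology)
        (simp add: Hausdorff_space_product_topology Hausdorff_space_mtopology)
    let ?Z = "prod_topology isometry_topology isometry_topology"
    show "continuous_map ?Z isometry_topology (\<lambda>(f, g). f \<otimes>\<^bsub>isometry_group\<^esub> g)"
    proof (rule continuous_map_into_isometry_topology)
      fix x assume x: "x \<in> M"
      have "continuous_map ?Z mtopology (\<lambda>z. fst z (snd z x))"
      proof (rule continuous_map_isometric_family[where F = fst and p = "\<lambda>z. snd z x"])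
        show "continuous_map ?Z mtopology (\<lambda>z. snd z x)"
          using continuous_map_compose[OF continuous_map_snd continuous_map_isometry_eval[OF x]]
          by (simp add: o_def)
        show "continuous_map ?Z mtopology (\<lambda>z. fst z y)" if "y \<in> M" for y
          using continuous_map_compose[OF continuous_map_fst continuous_map_isometry_eval[OF that]]
          by (simp add: o_def)
      qed (auto simp: isometry_dist)
      then show "continuous_map ?Z mtopology (\<lambda>z. (case z of (f, g) \<Rightarrow> f \<otimes>\<^bsub>isometry_group\<^esub> g) x)"
        by (rule continuous_map_eq) (auto simp: mult_isometry_group compose_eq x)
    qed (auto simp: mult_isometry_group isometry_compose)
    show "continuous_map isometry_topology isometry_topology (\<lambda>f. inv\<^bsub>isometry_group\<^esub> f)"
      by (rule continuous_map_eq[OF continuous_map_isometry_inverse])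
        (simp add: inv_isometry_group)
  qed
qed

text \<open>
  Restriction to a countable dense set \<open>D\<close> embeds the isometries into a countable product of metric
  spaces: an isometry is determined by its values on \<open>D\<close>, and values at nearby points of \<open>D\<close> control
  its value at any other point by the triangle inequality.
\<close>

lemma metrizable_isometry_topology:
  assumes "separable_space mtopology"
  shows "metrizable_space isometry_topology"
proof -
  obtain D where D: "countable D" "D \<subseteq> M" "mtopology closure_of D = M"
    using assms unfolding separable_space_def topspace_mtopology by (elim exE conjE)
  let ?R = "\<lambda>f. restrict f D"
  let ?P = "product_topology (\<lambda>_. mtopology) D"
  let ?Y = "subtopology ?P (?R ` isometries)"
  have approx: "\<exists>q\<in>D. d x q < \<epsilon>" if "x \<in> M" "\<epsilon> > 0" for x \<epsilon>
    using D(3) that unfolding metric_closure_of by auto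
  have inj: "inj_on ?R isometries"
  proof (intro inj_onI isometry_eqI)
    fix f g x assume f: "f \<in> isometries" and g: "g \<in> isometries" and eq: "?R f = ?R g" and x: "x \<in> M"
    have "d (f x) (g x) \<le> 0"
    proof (rule field_le_epsilon)
      fix \<epsilon> :: real assume "\<epsilon> > 0"
      then obtain q where q: "q \<in> D" "d x q < \<epsilon>/2" using approx[OF x, of "\<epsilon>/2"] by auto
      have qM: "q \<in> M" using q D by auto
      have "f q = g q" using eq q(1) by (metis restrict_apply')
      then have "d (f x) (g x) \<le> d (f x) (f q) + d (g q) (g x)"
        using triangle[of "f x" "f q" "g x"] isometry_in f g x qM by metis
      also have "\<dots> = d x q + d q x" using isometry_dist f g x qM by simp
      finally show "d (f x) (g x) \<le> 0 + \<epsilon>" using q(2) commute[of x q] by simp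
    qed
    then show "f x = g x" using isometry_in f g x nonneg zero by (metis order_antisym)
  qed auto
  define S where "S = inv_into isometries ?R"
  have SR: "S (?R f) = f" if "f \<in> isometries" for f
    unfolding S_def using inv_into_f_f[OF inj that] .
  have topY: "topspace ?Y = ?R ` isometries"
  proof -
    have "?R f \<in> topspace ?P" if "f \<in> isometries" for f
      using isometry_in[OF that] D(2) by auto
    then have "?R ` isometries \<subseteq> topspace ?P" by (rule image_subsetI)
    then show ?thesis unfolding topspace_subtopology by (rule Int_absorb1)
  qed
  have R_cont: "continuous_map isometry_topology ?Y ?R"
    unfolding continuous_map_in_subtopology continuous_map_componentwise
  proof (intro conjI ballI)
    show "?R ` topspace isometry_topology \<subseteq> extensional D" by auto
    show "continuous_map isometry_topology mtopology (\<lambda>f. ?R f q)" if "q \<in> D" for q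
      using continuous_map_isometry_eval[of q] that D(2) by auto
  qed auto
  have S_cont: "continuous_map ?Y isometry_topology S"
  proof (rule continuous_map_into_isometry_topology)
    show "S h \<in> isometries" if "h \<in> topspace ?Y" for h
      using that SR unfolding topY by auto
    fix x assume x: "x \<in> M"
    show "continuous_map ?Y mtopology (\<lambda>h. S h x)"
      unfolding continuous_map_to_metric
    proof (intro ballI allI impI)
      fix h and \<epsilon> :: real assume h: "h \<in> topspace ?Y" and \<epsilon>: "0 < \<epsilon>"
      then obtain f where f: "f \<in> isometries" "h = ?R f" unfolding topY by auto
      obtain q where q: "q \<in> D" "d x q < \<epsilon>/3" using approx[OF x, of "\<epsilon>/3"] \<epsilon> by auto
      have qM: "q \<in> M" using q D by auto
      have "continuous_map ?Y mtopology (\<lambda>h. h q)"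
        by (intro continuous_map_from_subtopology continuous_map_product_projection q)
      then obtain U where U: "openin ?Y U" "h \<in> U" "\<forall>k\<in>U. k q \<in> mball (h q) (\<epsilon>/3)"
        using h \<epsilon> unfolding continuous_map_to_metric by (metis zero_less_divide_iff zero_less_numeral)
      have "S k x \<in> mball (S h x) \<epsilon>" if k: "k \<in> U" for k
      proof -
        have "k \<in> topspace ?Y" using k U(1) openin_subset by blast
        then obtain g where g: "g \<in> isometries" "k = ?R g" unfolding topY by auto
        have "d (f q) (g q) < \<epsilon>/3" using U(3) k f g q by auto
        moreover have "d (f x) (f q) < \<epsilon>/3" "d (g q) (g x) < \<epsilon>/3"
          using isometry_dist f(1) g(1) x qM q(2) commute by auto
        moreover have "d (f x) (g x) \<le> d (f x) (f q) + (d (f q) (g q) + d (g q) (g x))"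
          using triangle[of "f x" "f q" "g x"] triangle[of "f q" "g q" "g x"]
            isometry_in[OF f(1) x] isometry_in[OF g(1) x] isometry_in[OF f(1) qM]
            isometry_in[OF g(1) qM] by linarith
        ultimately have "d (f x) (g x) < \<epsilon>" by linarith
        then show ?thesis using SR f g isometry_in[OF f(1) x] isometry_in[OF g(1) x] by simp
      qed
      then show "\<exists>U. openin ?Y U \<and> h \<in> U \<and> (\<forall>k\<in>U. S k x \<in> mball (S h x) \<epsilon>)"
        using U by blast
    qed
  qed
  have "homeomorphic_maps isometry_topology ?Y ?R S"
    unfolding homeomorphic_maps_def using R_cont S_cont SR topY by auto
  then have "isometry_topology homeomorphic_space ?Y" unfolding homeomorphic_space_def by blast
  moreover have "metrizable_space ?Y"
  proof (rule metrizable_space_subtopology)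
    have "countable {i \<in> D. \<not> (\<exists>a. topspace mtopology \<subseteq> {a})}" using D(1) by auto
    then show "metrizable_space ?P"
      unfolding metrizable_space_product_topology
      using metrizable_space_mtopology by blast
  qed
  ultimately show ?thesis using homeomorphic_metrizable_space by blast
qed

lemma continuous_map_dist:
  assumes "continuous_map Z mtopology f" "continuous_map Z mtopology g"
  shows "continuous_map Z euclideanreal (\<lambda>z. d (f z) (g z))"
  using continuous_map_mdist[of Z Self f g] assms by (simp add: mtopology_of_def)

text \<open>
  The distance-preserving maps \<open>f\<close> with \<open>d a (f a) \<le> r\<close> form a closed subset \<open>E\<close> of a product of
  closed balls, which is compact by Tychonoff's theorem. Surjectivity might be lost in a pointwise limit,
  so isometries are treated together with their inverses: they are the first components of the pairs in
  \<open>E \<times> E\<close> with \<open>f \<circ> g = id\<close>, a closed condition by joint continuity of the evaluation. The inverse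
  of \<open>f\<close> lies in \<open>E\<close> again since it moves \<open>a\<close> as far as \<open>f\<close> does.
\<close>

lemma compactin_isometries_bounded:
  assumes proper: "\<And>x r. x \<in> M \<Longrightarrow> compactin mtopology (mcball x r)" and a: "a \<in> M"
  shows "compactin isometry_topology {f \<in> isometries. d a (f a) \<le> r}"
proof -
  let ?P = "product_topology (\<lambda>_. mtopology) M"
  have M_nonempty: "M \<noteq> {}" using a by blast
  define E where "E = {f \<in> topspace ?P. d a (f a) \<in> {..r} \<and> (\<forall>x\<in>M. \<forall>y\<in>M. d (f x) (f y) \<in> {d x y})}"
  have E_dist: "d (f x) (f y) = d x y" if "f \<in> E" "x \<in> M" "y \<in> M" for f x y
    using that unfolding E_def by blast
  have E_in: "f x \<in> M" if "f \<in> E" "x \<in> M" for f x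
    using that unfolding E_def topspace_product_topology topspace_mtopology by blast
  have proj: "continuous_map ?P mtopology (\<lambda>f. f x)" if "x \<in> M" for x
    using continuous_map_product_projection[OF that, of "\<lambda>_. mtopology"] .
  have "closedin ?P E"
  proof -
    have E_eq: "E = {f \<in> topspace ?P. d a (f a) \<in> {..r}} \<inter>
      (\<Inter>x\<in>M. \<Inter>y\<in>M. {f \<in> topspace ?P. d (f x) (f y) \<in> {d x y}})"
      using a unfolding E_def by blast
    have bound: "closedin ?P {f \<in> topspace ?P. d a (f a) \<in> {..r}}"
      by (rule closedin_continuous_map_preimage[of _ euclideanreal])
        (intro continuous_map_dist proj a continuous_map_const[THEN iffD2], use a in auto)
    have cl: "closedin ?P {f \<in> topspace ?P. d (f x) (f y) \<in> {d x y}}" if "x \<in> M" "y \<in> M" for x y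
      by (rule closedin_continuous_map_preimage[of _ euclideanreal])
        (intro continuous_map_dist proj that, auto)
    have "closedin ?P (\<Inter>x\<in>M. \<Inter>y\<in>M. {f \<in> topspace ?P. d (f x) (f y) \<in> {d x y}})"
      by (intro closedin_INT cl M_nonempty)
    with bound show ?thesis unfolding E_eq by (rule closedin_Int)
  qed
  moreover have "compactin ?P (\<Pi>\<^sub>E x\<in>M. mcball a (r + d a x))"
    unfolding compactin_PiE using proper[OF a] by blast
  moreover have "E \<subseteq> (\<Pi>\<^sub>E x\<in>M. mcball a (r + d a x))"
  proof
    fix f assume f: "f \<in> E"
    have "d a (f x) \<le> r + d a x" if x: "x \<in> M" for x
    proof -
      have "d a (f x) \<le> d a (f a) + d (f a) (f x)" using triangle a E_in f x by blast
      moreover have "d a (f a) \<le> r" using f by (simp add: E_def)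
      ultimately show ?thesis using E_dist[OF f a x] by simp
    qed
    then show "f \<in> (\<Pi>\<^sub>E x\<in>M. mcball a (r + d a x))"
      using f a E_in[OF f] by (auto simp: E_def PiE_iff)
  qed
  ultimately have E: "compactin ?P E" using closed_compactin by blast
  let ?Z = "subtopology (prod_topology ?P ?P) (E \<times> E)"
  have "compactin (prod_topology ?P ?P) (E \<times> E)" using E by (simp add: compactin_Times)
  then have Z: "compact_space ?Z" by (simp add: compactin_subspace)
  have topZ: "topspace ?Z = E \<times> E" by (auto simp: E_def)
  define S where "S = {z \<in> topspace ?Z. \<forall>x\<in>M. fst z (snd z x) \<in> {x}}"
  have "closedin ?Z {z \<in> topspace ?Z. fst z (snd z x) \<in> {x}}" if x: "x \<in> M" for x
  proof (rule closedin_continuous_map_preimage)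
    show "closedin mtopology {x}"
      using x by (simp add: closedin_Hausdorff_sing_eq Hausdorff_space_mtopology)
    show "continuous_map ?Z mtopology (\<lambda>z. fst z (snd z x))"
    proof (rule continuous_map_isometric_family[where F = fst and p = "\<lambda>z. snd z x"])
      show "continuous_map ?Z mtopology (\<lambda>z. snd z x)"
        using continuous_map_from_subtopology[OF continuous_map_compose[OF continuous_map_snd proj[OF x]]]
        by (simp add: o_def)
      show "continuous_map ?Z mtopology (\<lambda>z. fst z y)" if "y \<in> M" for y
        using continuous_map_from_subtopology[OF continuous_map_compose[OF continuous_map_fst proj[OF that]]]
        by (simp add: o_def)
    qed (use topZ E_dist in auto)
  qed
  then have "closedin ?Z (\<Inter>x\<in>M. {z \<in> topspace ?Z. fst z (snd z x) \<in> {x}})"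
    by (intro closedin_INT[OF M_nonempty])
  moreover have "(\<Inter>x\<in>M. {z \<in> topspace ?Z. fst z (snd z x) \<in> {x}}) = S"
    using a unfolding S_def by blast
  ultimately have "compactin ?Z S" using closedin_compact_space[OF Z] by simp
  then have "compactin ?P (fst ` S)"
    by (rule image_compactin) (intro continuous_map_from_subtopology continuous_map_fst)
  moreover have "fst ` S = {f \<in> isometries. d a (f a) \<le> r}"
  proof (intro subset_antisym subsetI)
    fix f assume "f \<in> fst ` S"
    then obtain g where g: "f \<in> E" "g \<in> E" "\<forall>x\<in>M. f (g x) = x"
      unfolding S_def topZ by auto
    have "f \<in> isometries"
    proof (rule isometryI)
      show "f \<in> extensional M" using g(1) by (simp add: E_def PiE_iff)
      show "\<exists>x\<in>M. f x = y" if "y \<in> M" for y using g that E_in[OF g(2)] by blast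
    qed (use g(1) E_in E_dist in auto)
    then show "f \<in> {f \<in> isometries. d a (f a) \<le> r}" using g(1) by (simp add: E_def)
  next
    fix f assume "f \<in> {f \<in> isometries. d a (f a) \<le> r}"
    then have f: "f \<in> isometries" "d a (f a) \<le> r" by auto
    define g where "g = restrict (inv_into M f) M"
    have g: "g \<in> isometries" unfolding g_def by (rule isometry_inverse(1)[OF f(1)])
    have fg: "f (g x) = x" if "x \<in> M" for x
      using isometry_inverse(3)[OF f(1) that] that by (simp add: g_def)
    have iso_E: "k \<in> E" if "k \<in> isometries" "d a (k a) \<le> r" for k
      using that isometry_in isometry_extensional isometry_dist by (auto simp: E_def PiE_iff)
    have "d a (g a) = d (f a) (f (g a))" using isometry_dist[OF f(1) a isometry_in[OF g a]] by simp
    also have "\<dots> \<le> r" using f(2) fg[OF a] commute by simp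
    finally have "(f, g) \<in> S"
      unfolding S_def topZ using iso_E f g fg by auto
    then show "f \<in> fst ` S" by force
  qed
  ultimately show ?thesis
    unfolding isometry_topology_def compactin_subtopology by auto
qed

lemma locally_compact_isometry_topology:
  assumes proper: "\<And>x r. x \<in> M \<Longrightarrow> compactin mtopology (mcball x r)" and a: "a \<in> M"
  shows "locally_compact_space isometry_topology"
  unfolding locally_compact_space_def
proof
  fix f assume f: "f \<in> topspace isometry_topology"
  define r where "r = d a (f a) + 1"
  let ?U = "{g \<in> topspace isometry_topology. g a \<in> mball a r}"
  have "openin isometry_topology ?U"
    by (rule openin_continuous_map_preimage[OF continuous_map_isometry_eval[OF a]]) simp
  moreover have "f \<in> ?U" using f a isometry_in by (simp add: r_def)
  moreover have "?U \<subseteq> {g \<in> isometries. d a (g a) \<le> r}" by auto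
  ultimately show "\<exists>U K. openin isometry_topology U \<and> compactin isometry_topology K \<and> f \<in> U \<and> U \<subseteq> K"
    using compactin_isometries_bounded[OF proper a] by blast
qed

end

section \<open>The equivalence\<close>

text \<open>
  The model is the isometry group of \<open>G/H\<close> with the stabilizer \<open>S\<close> of the point \<open>H\<close>, where \<open>G\<close> acts
  by translations. The stabilizer is compact by properness. Evaluation at the point \<open>H\<close> descends to a
  continuous map \<open>ev\<close> on the coset space of \<open>S\<close>, and this is the inverse of the induced map, because
  translations already act transitively on \<open>G/H\<close>.
\<close>

lemma model_of_proper_invariant_metric:
  fixes G :: "('a, 'm) monoid_scheme"
  assumes "topological_group G T" and sc: "second_countable T" and H: "subgroup H G"
    and has: "has_proper_invariant_metric G T H"
  shows "\<exists>(G' :: ('a set \<Rightarrow> 'a set) monoid) T' H' \<phi>. proper_homogeneous_model G T H G' T' H' \<phi>"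
proof -
  interpret G: topological_group G T by fact
  define M where "M = lcosets\<^bsub>G\<^esub> H"
  obtain d where proper: "proper_metric M d"
    and top: "Metric_space.mtopology M d = coset_topology G T H"
    and invariant: "invariant_metric G H d"
    using has unfolding has_proper_invariant_metric_def M_def by (elim exE conjE)
  interpret Metric_space M d using proper by (simp add: proper_metric_def)
  have mcball: "compactin mtopology (mcball x r)" if "x \<in> M" for x r
    using proper that unfolding proper_metric_def by simp
  have H_in: "H \<in> M"
    using G.l_coset_in_lcosets[OF G.one_closed, of H] G.l_coset_subgroup[OF H] by (simp add: M_def)
  interpret I: topological_group isometry_group isometry_topology
    by (rule topological_group_isometry_group)

  define \<phi> where "\<phi> g = restrict (\<lambda>X. g <#\<^bsub>G\<^esub> X) M" for g
  have translate: "g <#\<^bsub>G\<^esub> X \<in> M" if "g \<in> carrier G" "X \<in> M" for g X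
    using G.translate_in_lcosets[OF H] that by (simp add: M_def)
  have assoc: "g <#\<^bsub>G\<^esub> (k <#\<^bsub>G\<^esub> X) = (g \<otimes>\<^bsub>G\<^esub> k) <#\<^bsub>G\<^esub> X"
    if gk: "g \<in> carrier G" "k \<in> carrier G" and X: "X \<in> M" for g k X
  proof -
    obtain x where "x \<in> carrier G" "X = x <#\<^bsub>G\<^esub> H" using X unfolding M_def by (rule G.lcosetsE)
    then show ?thesis using gk by (simp add: G.l_coset_l_coset[OF H] G.m_assoc)
  qed
  have one: "\<one>\<^bsub>G\<^esub> <#\<^bsub>G\<^esub> X = X" if X: "X \<in> M" for X
  proof -
    obtain x where "x \<in> carrier G" "X = x <#\<^bsub>G\<^esub> H" using X unfolding M_def by (rule G.lcosetsE)
    then show ?thesis by (simp add: G.l_coset_l_coset[OF H])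
  qed
  have \<phi>_iso: "\<phi> g \<in> isometries" if g: "g \<in> carrier G" for g
  proof (rule isometryI)
    show "d (\<phi> g X) (\<phi> g Y) = d X Y" if "X \<in> M" "Y \<in> M" for X Y
      using invariant g that unfolding invariant_metric_def \<phi>_def M_def by simp
    show "\<exists>X\<in>M. \<phi> g X = Y" if Y: "Y \<in> M" for Y
    proof
      show "inv\<^bsub>G\<^esub> g <#\<^bsub>G\<^esub> Y \<in> M" using translate g Y by simp
      then show "\<phi> g (inv\<^bsub>G\<^esub> g <#\<^bsub>G\<^esub> Y) = Y" using g Y by (simp add: \<phi>_def assoc one)
    qed
  qed (use translate g in \<open>auto simp: \<phi>_def\<close>)
  have \<phi>_hom: "\<phi> \<in> hom G isometry_group"
  proof (rule homI)
    show "\<phi> (g \<otimes>\<^bsub>G\<^esub> k) = \<phi> g \<otimes>\<^bsub>isometry_group\<^esub> \<phi> k" if "g \<in> carrier G" "k \<in> carrier G" for g k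
      unfolding mult_isometry_group[OF \<phi>_iso[OF that(1)] \<phi>_iso[OF that(2)]]
      unfolding \<phi>_def compose_def
      by (rule restrict_ext) (simp add: translate assoc that)
  qed (simp add: \<phi>_iso)
  have \<phi>_cont: "continuous_map T isometry_topology \<phi>"
  proof (rule continuous_map_into_isometry_topology)
    show "\<phi> g \<in> isometries" if "g \<in> topspace T" for g using \<phi>_iso that by (simp add: G.topspace_eq)
    fix X assume X: "X \<in> M"
    then obtain k where k: "k \<in> carrier G" "X = k <#\<^bsub>G\<^esub> H" unfolding M_def by (rule G.lcosetsE)
    have "continuous_map T (coset_topology G T H) (\<lambda>g. (g \<otimes>\<^bsub>G\<^esub> k) <#\<^bsub>G\<^esub> H)"
      using continuous_map_compose[OF G.continuous_map_right_translation[OF k(1)]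
          G.continuous_map_coset_projection[of H]] by (simp add: o_def)
    then show "continuous_map T mtopology (\<lambda>g. \<phi> g X)"
      unfolding top
      by (rule continuous_map_eq) (use X k in \<open>simp add: \<phi>_def G.topspace_eq G.l_coset_l_coset[OF H]\<close>)
  qed

  define S where "S = {f \<in> isometries. f H = H}"
  have mult: "(f \<otimes>\<^bsub>isometry_group\<^esub> g) H = f (g H)" if "f \<in> isometries" "g \<in> isometries" for f g
    using that H_in by (simp add: mult_isometry_group compose_eq)
  have inv_eq: "(inv\<^bsub>isometry_group\<^esub> f) (f H) = H" if "f \<in> isometries" for f
    using that H_in isometry_in[OF that H_in] by (simp add: inv_isometry_group isometry_inverse(4))
  have S_group: "subgroup S isometry_group"
  proof (rule I.subgroupI)
    show "S \<subseteq> carrier isometry_group" by (auto simp: S_def)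
    show "S \<noteq> {}"
    proof -
      have "\<phi> \<one>\<^bsub>G\<^esub> \<in> S" using \<phi>_iso[OF G.one_closed] one[OF H_in] H_in by (simp add: S_def \<phi>_def)
      then show ?thesis by blast
    qed
    show "inv\<^bsub>isometry_group\<^esub> f \<in> S" if "f \<in> S" for f
      using that inv_eq[of f] I.inv_closed[of f] by (simp add: S_def)
    show "f \<otimes>\<^bsub>isometry_group\<^esub> g \<in> S" if "f \<in> S" "g \<in> S" for f g
      using that mult[of f g] I.m_closed[of f g] by (simp add: S_def)
  qed
  have S_compact: "compactin isometry_topology S"
  proof -
    have "S = {f \<in> isometries. d H (f H) \<le> 0}"
      using isometry_in[OF _ H_in] H_in nonneg zero unfolding S_def by (metis order_antisym order_refl)
    then show ?thesis using compactin_isometries_bounded[OF mcball H_in, of 0] by simp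
  qed
  have \<phi>_H: "\<phi> ` H \<subseteq> S"
  proof (rule image_subsetI)
    fix h assume h: "h \<in> H"
    then have hc: "h \<in> carrier G" using subgroup.mem_carrier[OF H] by blast
    have "\<phi> h H = H"
      using G.l_coset_eq_iff[OF H G.one_closed hc] G.l_coset_subgroup[OF H] h hc H_in
      by (simp add: \<phi>_def)
    then show "\<phi> h \<in> S" using \<phi>_iso[OF hc] by (simp add: S_def)
  qed

  define \<psi> where "\<psi> = induced_coset_map G H isometry_group S \<phi>"
  have \<psi>: "\<psi> (g <#\<^bsub>G\<^esub> H) = \<phi> g <#\<^bsub>isometry_group\<^esub> S" if "g \<in> carrier G" for g
    unfolding \<psi>_def
    by (rule induced_coset_map_eq[OF G.is_group I.is_group H S_group \<phi>_hom \<phi>_H that])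
  define ev where "ev F = (SOME f. f \<in> F) H" for F :: "('a set \<Rightarrow> 'a set) set"
  have ev: "ev (f <#\<^bsub>isometry_group\<^esub> S) = f H" if f: "f \<in> isometries" for f
  proof -
    define k where "k = (SOME k. k \<in> f <#\<^bsub>isometry_group\<^esub> S)"
    have "f \<in> f <#\<^bsub>isometry_group\<^esub> S" using I.lcos_self[OF _ S_group] f by simp
    then have "k \<in> f <#\<^bsub>isometry_group\<^esub> S" 
      unfolding k_def by (rule someI[where P = "\<lambda>k. k \<in> f <#\<^bsub>isometry_group\<^esub> S"])
    then obtain s where "s \<in> S" "k = f \<otimes>\<^bsub>isometry_group\<^esub> s" by (auto simp: l_coset_def)
    then have "k H = f H" using mult[OF f, of s] by (simp add: S_def)
    then show ?thesis by (simp add: ev_def k_def)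
  qed
  have \<phi>_base: "\<phi> g H = g <#\<^bsub>G\<^esub> H" for g using H_in by (simp add: \<phi>_def)
  let ?X = "coset_topology G T H" and ?Y = "coset_topology isometry_group isometry_topology S"
  have "homeomorphic_maps ?X ?Y \<psi> ev"
    unfolding homeomorphic_maps_def
  proof (intro conjI ballI)
    show "continuous_map ?X ?Y \<psi>"
    proof (rule G.continuous_map_from_coset_topology)
      have "continuous_map T ?Y (\<lambda>g. \<phi> g <#\<^bsub>isometry_group\<^esub> S)"
        using continuous_map_compose[OF \<phi>_cont I.continuous_map_coset_projection[of S]]
        by (simp add: o_def)
      then show "continuous_map T ?Y (\<lambda>g. \<psi> (g <#\<^bsub>G\<^esub> H))"
        by (rule continuous_map_eq) (simp add: \<psi> G.topspace_eq)
    qed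
    show "continuous_map ?Y ?X ev"
    proof (rule I.continuous_map_from_coset_topology)
      show "continuous_map isometry_topology ?X (\<lambda>f. ev (f <#\<^bsub>isometry_group\<^esub> S))"
        using continuous_map_isometry_eval[OF H_in] unfolding top
        by (rule continuous_map_eq) (simp add: ev)
    qed
    show "ev (\<psi> X) = X" if X: "X \<in> topspace ?X" for X
    proof -
      obtain g where g: "g \<in> carrier G" "X = g <#\<^bsub>G\<^esub> H"
        using X unfolding G.topspace_coset_topology by (rule G.lcosetsE)
      show ?thesis by (simp add: g(2) \<psi>[OF g(1)] ev[OF \<phi>_iso[OF g(1)]] \<phi>_base)
    qed
    show "\<psi> (ev F) = F" if F: "F \<in> topspace ?Y" for F
    proof -
      obtain f where f: "f \<in> carrier isometry_group" "F = f <#\<^bsub>isometry_group\<^esub> S"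
        using F unfolding I.topspace_coset_topology by (rule I.lcosetsE)
      then have f': "f \<in> isometries" by simp
      obtain g where g: "g \<in> carrier G" "f H = g <#\<^bsub>G\<^esub> H"
        using isometry_in[OF f' H_in] unfolding M_def by (rule G.lcosetsE)
      have inv: "inv\<^bsub>isometry_group\<^esub> (\<phi> g) \<in> isometries"
        using I.inv_closed[of "\<phi> g"] \<phi>_iso[OF g(1)] by simp
      have "(inv\<^bsub>isometry_group\<^esub> (\<phi> g) \<otimes>\<^bsub>isometry_group\<^esub> f) H = H"
        using mult[OF inv f'] inv_eq[OF \<phi>_iso[OF g(1)]] g(2) \<phi>_base by simp
      then have "inv\<^bsub>isometry_group\<^esub> (\<phi> g) \<otimes>\<^bsub>isometry_group\<^esub> f \<in> S"
        using I.m_closed[of "inv\<^bsub>isometry_group\<^esub> (\<phi> g)" f] inv f' by (simp add: S_def)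
      then have "\<phi> g <#\<^bsub>isometry_group\<^esub> S = f <#\<^bsub>isometry_group\<^esub> S"
        using I.l_coset_eq_iff[OF S_group, of "\<phi> g" f] \<phi>_iso[OF g(1)] f' by simp
      then show ?thesis by (simp add: f(2) ev[OF f'] g(2) \<psi>[OF g(1)])
    qed
  qed
  then have homeo: "homeomorphic_map ?X ?Y \<psi>" unfolding homeomorphic_map_maps by blast

  have "second_countable ?X"
    by (rule G.second_countable_coset_topology[OF H sc])
  then have "separable_space mtopology"
    unfolding top by (rule second_countable_imp_separable_space)
  then have "metrizable_space isometry_topology" by (rule metrizable_isometry_topology)
  moreover have "locally_compact_space isometry_topology"
    using locally_compact_isometry_topology[OF mcball H_in] .
  ultimately have "proper_homogeneous_model G T H isometry_group isometry_topology S \<phi>"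
    unfolding proper_homogeneous_model_def
    using topological_group_isometry_group \<phi>_hom \<phi>_cont S_group S_compact \<phi>_H homeo
    unfolding \<psi>_def by (intro conjI)
  then show ?thesis by blast
qed

theorem proposition2p7:
  fixes G :: "('a, 'm) monoid_scheme" and T :: "'a topology" and H :: "'a set"
  assumes "topological_group G T"
    and "second_countable T"
    and "locally_compact_space T"
    and "subgroup H G"
    and "closedin T H"
  shows "(has_proper_invariant_metric G T H \<longleftrightarrow>
           (\<exists>(G' :: ('a set \<Rightarrow> 'a set) monoid) T' H' \<phi>.
              proper_homogeneous_model G T H G' T' H' \<phi>)) \<and>
         ((\<exists>(G' :: 'b monoid) T' H' \<phi>. proper_homogeneous_model G T H G' T' H' \<phi>) \<longrightarrow>
           has_proper_invariant_metric G T H)"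
proof (intro conjI iffI impI)
  assume "has_proper_invariant_metric G T H"
  then show "\<exists>(G' :: ('a set \<Rightarrow> 'a set) monoid) T' H' \<phi>. proper_homogeneous_model G T H G' T' H' \<phi>"
    by (rule model_of_proper_invariant_metric[OF assms(1,2,4)])
next
  assume "\<exists>(G' :: ('a set \<Rightarrow> 'a set) monoid) T' H' \<phi>. proper_homogeneous_model G T H G' T' H' \<phi>"
  then show "has_proper_invariant_metric G T H"
    by (elim exE) (rule has_proper_invariant_metric_of_model[OF assms])
next
  assume "\<exists>(G' :: 'b monoid) T' H' \<phi>. proper_homogeneous_model G T H G' T' H' \<phi>"
  then show "has_proper_invariant_metric G T H"
    by (elim exE) (rule has_proper_invariant_metric_of_model[OF assms])
qed

end
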